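(* Let $(f_n)$ be a sequence of functions with the Baire property from a Polish space $(X,d)$ to a complete metric space $(Z,\rho)$. Assume that $\mathcal I$ is an ideal on $\mathbb N$ which is either analytic or coanalytic. If the sequence $(f_n)$ is divergent on a comeager set in $X$ (i.e. $\{x\in X\colon (f_n(x))\text{ is divergent}\}$ is comeager in $X$), then the sets $$\{s \in S \colon \{x \in X \colon (f_{s(n)}(x)) \text{ is } \mathcal I\text{-convergent}\} \text{ is meager in } X\},$$ $$\{p \in P \colon \{x \in X \colon (f_{p(n)}(x)) \text{ is } \mathcal I\text{-convergent}\} \text{ is meager in } X\}$$ are comeager in $S$ and $P$, respectively.
   Context: $\mathbb N=\{1,2,\dots\}$. $S:=\{ s\in\mathbb N^{\mathbb N}\colon \forall n\in\mathbb N\; s(n)<s(n+1)\}$ and $P:=\{ p\in\mathbb N^{\mathbb N}\colon p\text{ is a bijection}\}$, both with the subspace topology inherited from $\mathbb N^{\mathbb N}$ (product of discrete spaces); they are $G_\delta$ subsets of $\mathbb N^{\mathbb N}$, hence Polish spaces. All ideals are assumed admissible: an ideal on $\mathbb N$ is an ideal $\mathcal I\subset\mathcal P(\mathbb N)$ (a family closed under subsets and finite unions) such that $\mathbb N\notin\mathcal I$ and every finite subset of $\mathbb N$ belongs to $\mathcal I$. Via characteristic functions, $\mathcal I$ is regarded as a subset of the Polish space $\{0,1\}^{\mathbb N}$; "analytic" and "coanalytic" refer to this space. A sequence $(z_n)$ in a metric space $(Z,\rho)$ is $\mathcal I$-convergent to $z\in Z$ if for every $\varepsilon>0$ we have $\{n\in\mathbb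 N\colon \rho(z_n,z)\ge\varepsilon\}\in\mathcal I$; it is $\mathcal I$-convergent if it is $\mathcal I$-convergent to some $z\in Z$. "Divergent" means not convergent (in the usual sense) to any point of $Z$. Sets with the Baire property in a metric space form the smallest $\sigma$-algebra containing the open sets and the meager sets. A mapping from a metric space $X$ to a metric space $Z$ has the Baire property if the preimage of any open set in $Z$ has the Baire property in $X$. *)

theory Defs
  imports "HOL-Analysis.Analysis"
begin

text \<open>The positive integers are represented by the type \<^typ>\<open>nat\<close> through the shift
  $n \mapsto n - 1$; it is an order isomorphism, so all notions below transfer verbatim.
  The type \<^typ>\<open>nat \<Rightarrow> nat\<close> carries the product of the discrete topologies (this is
  the library instance for function types), and so does \<^typ>\<open>nat \<Rightarrow> bool\<close>, which
  serves as the Cantor space.\<close>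

definition nowhere_dense_in :: "'a topology \<Rightarrow> 'a set \<Rightarrow> bool" where
  "nowhere_dense_in T A \<longleftrightarrow>
     A \<subseteq> topspace T \<and> T interior_of (T closure_of A) = {}"

definition meager_in :: "'a topology \<Rightarrow> 'a set \<Rightarrow> bool" where
  "meager_in T A \<longleftrightarrow>
     (\<exists>N :: nat \<Rightarrow> 'a set. (\<forall>k. nowhere_dense_in T (N k)) \<and> A = (\<Union>k. N k))"

definition comeager_in :: "'a topology \<Rightarrow> 'a set \<Rightarrow> bool" where
  "comeager_in T A \<longleftrightarrow> A \<subseteq> topspace T \<and> meager_in T (topspace T - A)"

definition baire_property_sets :: "'a topology \<Rightarrow> 'a set set" where
  "baire_property_sets T = sigma_sets (topspace T) ({U. openin T U} \<union> {M. meager_in T M})"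

definition baire_property_map :: "('a::topological_space \<Rightarrow> 'b::topological_space) \<Rightarrow> bool" where
  "baire_property_map g \<longleftrightarrow> (\<forall>U. open U \<longrightarrow> g -` U \<in> baire_property_sets euclidean)"

text \<open>Every nonempty Polish space is a continuous image of the Baire space, so these are
  the continuous images of Polish spaces.\<close>

definition analytic_set :: "'a::topological_space set \<Rightarrow> bool" where
  "analytic_set A \<longleftrightarrow>
     A = {} \<or> (\<exists>h :: (nat \<Rightarrow> nat) \<Rightarrow> 'a. continuous_on UNIV h \<and> A = range h)"

definition coanalytic_set :: "'a::topological_space set \<Rightarrow> bool" where
  "coanalytic_set A \<longleftrightarrow> analytic_set (- A)"

definition admissible_ideal :: "nat set set \<Rightarrow> bool" where
  "admissible_ideal I \<longleftrightarrow>
     (\<forall>A\<in>I. \<forall>B. B \<subseteq> A \<longrightarrow> B \<in> I) \<and>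
     (\<forall>A\<in>I. \<forall>B\<in>I. A \<union> B \<in> I) \<and>
     UNIV \<notin> I \<and>
     (\<forall>A. finite A \<longrightarrow> A \<in> I)"

definition char_functions :: "nat set set \<Rightarrow> (nat \<Rightarrow> bool) set" where
  "char_functions I = (\<lambda>A n. n \<in> A) ` I"

definition ideal_converges_to ::
    "nat set set \<Rightarrow> (nat \<Rightarrow> 'b::metric_space) \<Rightarrow> 'b \<Rightarrow> bool" where
  "ideal_converges_to I z l \<longleftrightarrow> (\<forall>\<epsilon>>0. {n. dist (z n) l \<ge> \<epsilon>} \<in> I)"

definition ideal_convergent :: "nat set set \<Rightarrow> (nat \<Rightarrow> 'b::metric_space) \<Rightarrow> bool" where
  "ideal_convergent I z \<longleftrightarrow> (\<exists>l. ideal_converges_to I z l)"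

definition S_space :: "(nat \<Rightarrow> nat) set" where
  "S_space = {s. \<forall>n. s n < s (Suc n)}"

definition P_space :: "(nat \<Rightarrow> nat) set" where
  "P_space = {p. bij p}"

end

theory Submission
  imports Defs
begin

text \<open>An analytic or coanalytic ideal has the Baire property, so by Jalali-Naini and Talagrand there
  are blocks \<open>{b k..<b (Suc k)}\<close> of which no member of the ideal contains infinitely many. If
  \<open>f n x\<close> is not Cauchy, then for some \<open>\<delta> > 0\<close> and every \<open>j\<close> infinitely many \<open>f m x\<close> have distance
  at least \<open>\<delta>\<close> from \<open>f j x\<close>; a generic \<open>s\<close> maps infinitely many blocks into this set of indices
  \<open>m\<close>, whereas ideal convergence of \<open>f (s n) x\<close> would bring some \<open>f j x\<close> closer than \<open>\<delta>\<close> to all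
  values outside a member of the ideal.

  This is made uniform in \<open>x\<close> by a Baire category argument, for which the sets
  \<open>{x. dist (f m x) (f j x) < \<delta>}\<close> must have the Baire property. As the target need not be separable,
  this requires that a map with the Baire property on a Polish space has, off a meager set,
  a separable range.\<close>

section \<open>Meager sets and the Baire property\<close>

text \<open>The generic \<open>s\<close> must serve all points outside one meager set, whereas the
  divergence of the sequence at \<open>x\<close> and its possible ideal limits depend on
  \<open>x\<close>. Since terms \<open>f j x\<close> stand in for limits, only countably many
  parameters \<open>(i, j, K)\<close> occur (scale, reference index, first block considered), and
  each contributes one comeager set of \<open>s\<close>. For a fixed parameter the continuation of
  \<open>s\<close> that works still depends on \<open>x\<close>, but only through a finite list of
  values; countably many lists cover the relevant set, so one of them works on a nonmeager part.
  \<open>S_space\<close> and \<open>P_space\<close> enter through a common extension property: a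
  finite initial segment can be continued by a long block of values from any infinite set.

  Separability off a meager set rests on a fact about partitions: a nonempty Polish space has no
  partition into meager sets all of whose unions have the Baire property. Rounding the values of a
  map to suitable centres makes all unions of fibres have the Baire property, so this fact
  applies.\<close>

abbreviation meager :: "'a::topological_space set \<Rightarrow> bool" where
  "meager \<equiv> meager_in euclidean"

lemma nowhere_dense_in_euclidean:
  "nowhere_dense_in euclidean A \<longleftrightarrow> interior (closure A) = {}"
  by (simp add: nowhere_dense_in_def)

lemma nowhere_dense_in_subset:
  assumes "nowhere_dense_in T A" "B \<subseteq> A"
  shows "nowhere_dense_in T B"
  using assms interior_of_mono[OF closure_of_mono[OF assms(2)], of T T]
  unfolding nowhere_dense_in_def by blast

lemma nowhere_dense_in_empty: "nowhere_dense_in T {}"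
  by (simp add: nowhere_dense_in_def)

lemma nowhere_dense_in_imp_meager_in:
  assumes "nowhere_dense_in T A"
  shows "meager_in T A"
  unfolding meager_in_def using assms by (intro exI[of _ "\<lambda>_. A"]) simp

lemma meager_in_subset:
  assumes "meager_in T A" "B \<subseteq> A"
  shows "meager_in T B"
proof -
  obtain N :: "nat \<Rightarrow> _" where N: "\<And>k. nowhere_dense_in T (N k)" "A = (\<Union>k. N k)"
    using assms(1) unfolding meager_in_def by auto
  show ?thesis unfolding meager_in_def
    using N assms(2) by (intro exI[of _ "\<lambda>k. N k \<inter> B"]) (auto intro: nowhere_dense_in_subset)
qed

lemma meager_in_empty: "meager_in T {}"
  by (simp add: nowhere_dense_in_empty nowhere_dense_in_imp_meager_in)

lemma meager_in_UN_nat: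
  fixes A :: "nat \<Rightarrow> 'a set"
  assumes "\<And>i. meager_in T (A i)"
  shows "meager_in T (\<Union>i. A i)"
proof -
  obtain N :: "nat \<Rightarrow> nat \<Rightarrow> 'a set"
    where N: "\<And>i k. nowhere_dense_in T (N i k)" "\<And>i. A i = (\<Union>k. N i k)"
    using assms unfolding meager_in_def by metis
  have "(\<Union>i. A i) = (\<Union>n. case_prod N (prod_decode n))"
    by (auto simp: N(2)) (metis prod_encode_inverse case_prod_conv)
  moreover have "nowhere_dense_in T (case_prod N (prod_decode n))" for n
    by (simp add: N(1) split: prod.split)
  ultimately show ?thesis
    unfolding meager_in_def by (intro exI[of _ "\<lambda>n. case_prod N (prod_decode n)"]) simp
qed

lemma meager_in_UN:
  assumes "countable J" "\<And>i. i \<in> J \<Longrightarrow> meager_in T (A i)"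
  shows "meager_in T (\<Union>i\<in>J. A i)"
proof (cases "J = {}")
  case False
  then have "(\<Union>i\<in>J. A i) = (\<Union>n. A (from_nat_into J n))"
    by (metis assms(1) image_image range_from_nat_into)
  then show ?thesis
    using meager_in_UN_nat[of T "\<lambda>n. A (from_nat_into J n)"] assms(2) from_nat_into[OF False] by simp
qed (simp add: meager_in_empty)

lemma meager_in_Un:
  assumes "meager_in T A" "meager_in T B"
  shows "meager_in T (A \<union> B)"
  using meager_in_UN[of "{A, B}" T id] assms by auto

lemma meager_closed_diff_interior:
  assumes "closed C"
  shows "meager (C - interior C)"
proof -
  have "closed (C - interior C)" using assms by auto
  moreover have "interior (C - interior C) = {}"
  proof -
    have "interior (C - interior C) \<subseteq> interior C" by (intro interior_mono) auto
    moreover have "interior (C - interior C) \<subseteq> C - interior C" by (rule interior_subset)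
    ultimately show ?thesis by blast
  qed
  ultimately have "nowhere_dense_in euclidean (C - interior C)"
    unfolding nowhere_dense_in_euclidean by (simp add: closure_closed)
  then show ?thesis by (rule nowhere_dense_in_imp_meager_in)
qed

text \<open>Closed sets can be avoided one at a time in a construction, and monotonicity makes it
  enough to avoid \<open>F k\<close> for infinitely many \<open>k\<close>.\<close>

lemma meager_closed_incseq:
  assumes "meager A"
  obtains F :: "nat \<Rightarrow> 'a::topological_space set"
  where "\<And>n. closed (F n)" "\<And>n. interior (F n) = {}" "incseq F" "A \<subseteq> (\<Union>n. F n)"
proof -
  obtain N :: "nat \<Rightarrow> 'a set"
    where N: "\<And>k. interior (closure (N k)) = {}" "A = (\<Union>k. N k)"
    using assms unfolding meager_in_def nowhere_dense_in_euclidean by auto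
  define F where "F n = (\<Union>k\<le>n. closure (N k))" for n
  have F: "F (Suc n) = closure (N (Suc n)) \<union> F n" for n
    unfolding F_def by (auto simp: le_Suc_eq)
  have cl: "closed (F n)" for n unfolding F_def by auto
  have "interior (F n) = {}" for n
  proof (induction n)
    case 0 then show ?case by (simp add: F_def N)
  next
    case (Suc n)
    then show ?case unfolding F using N(1) cl interior_closed_Un_empty_interior
      by (metis Un_commute)
  qed
  moreover have "incseq F" unfolding F_def incseq_def by (intro allI impI UN_mono) auto
  moreover have "A \<subseteq> (\<Union>n. F n)" unfolding F_def N(2) using closure_subset by fastforce
  ultimately show ?thesis using that cl by blast
qed

lemma baire_property_sets_compl:
  assumes "A \<in> baire_property_sets euclidean"
  shows "- A \<in> baire_property_sets euclidean"
  using assms sigma_sets.Compl[of A UNIV] unfolding baire_property_sets_def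
  by (simp add: Compl_eq_Diff_UNIV)

lemma baire_property_sets_UN:
  assumes "countable J" "\<And>i. i \<in> J \<Longrightarrow> A i \<in> baire_property_sets euclidean"
  shows "(\<Union>i\<in>J. A i) \<in> baire_property_sets euclidean"
  using assms unfolding baire_property_sets_def by (intro sigma_sets_UNION) auto

lemma baire_property_sets_Un:
  assumes "A \<in> baire_property_sets euclidean" "B \<in> baire_property_sets euclidean"
  shows "A \<union> B \<in> baire_property_sets euclidean"
  using baire_property_sets_UN[of "{A, B}" id] assms by auto

lemma baire_property_sets_INT:
  assumes "countable J" "\<And>i. i \<in> J \<Longrightarrow> A i \<in> baire_property_sets euclidean"
  shows "(\<Inter>i\<in>J. A i) \<in> baire_property_sets euclidean"
proof -
  have "- (\<Union>i\<in>J. - A i) \<in> baire_property_sets euclidean"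
    using assms by (intro baire_property_sets_compl baire_property_sets_UN)
  then show ?thesis by simp
qed

lemma baire_property_sets_Int:
  assumes "A \<in> baire_property_sets euclidean" "B \<in> baire_property_sets euclidean"
  shows "A \<inter> B \<in> baire_property_sets euclidean"
  using baire_property_sets_INT[of "{A, B}" id] assms by auto

lemma open_baire_property_sets: "open U \<Longrightarrow> U \<in> baire_property_sets euclidean"
  unfolding baire_property_sets_def by (auto intro: sigma_sets.Basic)

lemma meager_baire_property_sets: "meager M \<Longrightarrow> M \<in> baire_property_sets euclidean"
  unfolding baire_property_sets_def by (auto intro: sigma_sets.Basic)

text \<open>Sets that are open modulo a meager set form a sigma-algebra; for complements this holds
  because a closed set differs from its interior by a nowhere dense set.\<close>

lemma baire_property_setsE:
  assumes "A \<in> baire_property_sets euclidean"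
  obtains U where "open U" "meager (A - U)" "meager (U - A)"
proof -
  have "\<exists>U. open U \<and> meager ((A - U) \<union> (U - A))"
    using assms unfolding baire_property_sets_def
  proof (induction rule: sigma_sets.induct)
    case (Basic a)
    then show ?case
      by (auto intro: exI[of _ a] exI[of _ "{}"] simp: meager_in_empty)
  next
    case Empty
    then show ?case by (auto intro: exI[of _ "{}"] simp: meager_in_empty)
  next
    case (Compl a)
    then obtain U where U: "open U" "meager ((a - U) \<union> (U - a))" by blast
    have "meager (- U - interior (- U))" using U by (intro meager_closed_diff_interior) auto
    from meager_in_Un[OF this U(2)] have "meager ((- U - interior (- U)) \<union> ((a - U) \<union> (U - a)))" .
    then have "meager ((topspace euclidean - a - interior (- U)) \<union> (interior (- U) - (topspace euclidean - a)))"
      by (rule meager_in_subset) (use interior_subset in auto)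
    then show ?case by blast
  next
    case (Union a)
    then obtain U where U: "\<And>i. open (U i)" "\<And>i::nat. meager ((a i - U i) \<union> (U i - a i))" by metis
    have "meager (\<Union>i. (a i - U i) \<union> (U i - a i))" using U by (intro meager_in_UN_nat)
    then have "meager (((\<Union>i. a i) - (\<Union>i. U i)) \<union> ((\<Union>i. U i) - (\<Union>i. a i)))"
      by (rule meager_in_subset) auto
    then show ?case using U(1) by (intro exI[of _ "\<Union>i. U i"]) auto
  qed
  then show ?thesis using that by (meson meager_in_subset Un_upper1 Un_upper2)
qed

lemma nonmeager_countable_basis:
  fixes A :: "'a::topological_space set" and B :: "'a set set"
  assumes "countable B" "topological_basis B" "open U" "\<not> meager (A \<inter> U)"
  obtains V where "V \<in> B" "V \<subseteq> U" "\<not> meager (A \<inter> V)"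
proof -
  obtain B' where B': "B' \<subseteq> B" "\<Union>B' = U"
    using topological_basis assms(2,3) by metis
  have "\<exists>V\<in>B'. \<not> meager (A \<inter> V)"
  proof (rule ccontr)
    assume "\<not> (\<exists>V\<in>B'. \<not> meager (A \<inter> V))"
    then have "meager (\<Union>V\<in>B'. A \<inter> V)"
      using countable_subset[OF B'(1) assms(1)] by (intro meager_in_UN) auto
    then show False using assms(4) B'(2) by (simp add: Int_Union)
  qed
  then show ?thesis using that B' by blast
qed

text \<open>\<open>A\<close> is comeager in every part of an open set equal to it modulo a meager
  set. Carrying \<open>E\<close> along selects a part where \<open>A \<inter> E\<close> is still
  nonmeager.\<close>

lemma baire_property_sets_comeager_in_open:
  fixes A :: "'a::topological_space set" and B :: "'a set set"
  assumes "A \<in> baire_property_sets euclidean" "countable B" "topological_basis B" "\<not> meager (A \<inter> E)"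
  obtains U where "U \<in> B" "\<not> meager (A \<inter> E \<inter> U)" "meager (U - A)"
proof -
  obtain U where U: "open U" "meager (A - U)" "meager (U - A)"
    using baire_property_setsE assms(1) by blast
  have "\<not> meager (A \<inter> E \<inter> U)"
  proof
    assume "meager (A \<inter> E \<inter> U)"
    from meager_in_Un[OF this U(2)] have "meager (A \<inter> E)"
      by (rule meager_in_subset) auto
    then show False using assms by blast
  qed
  then obtain V where "V \<in> B" "V \<subseteq> U" "\<not> meager (A \<inter> E \<inter> V)"
    using nonmeager_countable_basis assms U(1) by metis
  moreover have "meager (V - A)" using U(3) by (rule meager_in_subset) (use \<open>V \<subseteq> U\<close> in auto)
  ultimately show ?thesis using that by blast
qed

text \<open>The complete alternative serves the Polish space, the locally compact one the Cantor
  space.\<close>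

lemma Baire_open_not_meager:
  fixes U :: "'a::topological_space set"
  assumes "completely_metrizable_space (euclidean :: 'a topology) \<or>
      locally_compact_space (euclidean :: 'a topology) \<and> regular_space (euclidean :: 'a topology)"
    and "open U" "U \<noteq> {}"
  shows "\<not> meager U"
proof
  assume "meager U"
  then obtain F :: "nat \<Rightarrow> 'a set" where F: "\<And>n. closed (F n)" "\<And>n. interior (F n) = {}" "U \<subseteq> (\<Union>n. F n)"
    using meager_closed_incseq by metis
  have "euclidean interior_of \<Union>(range F) = {}"
    using assms(1) F by (intro Baire_category_alt) auto
  then have "interior (\<Union>n. F n) = {}" by simp
  then show False using F(3) assms(2,3) interior_maximal by blast
qed

lemma nonempty_open_Diff:
  assumes "interior F = {}" "closed F" "open U" "U \<noteq> {}"
  shows "open (U - F)" "U - F \<noteq> {}"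
  using assms interior_maximal[of U F] by (auto simp: open_Diff)

section \<open>Analytic sets have the Baire property\<close>

text \<open>Kuratowski's set of points at which \<open>A\<close> is of the second category, used as
  a closed substitute for \<open>A\<close>.\<close>

definition locally_nonmeager_points :: "'a::topological_space set \<Rightarrow> 'a set" where
  "locally_nonmeager_points A = {x. \<forall>U. open U \<longrightarrow> x \<in> U \<longrightarrow> \<not> meager (A \<inter> U)}"

lemma closed_locally_nonmeager_points: "closed (locally_nonmeager_points A)"
proof -
  have "open (- locally_nonmeager_points A)"
    by (subst open_subopen) (auto simp: locally_nonmeager_points_def)
  then show ?thesis by (simp add: closed_def)
qed

lemma locally_nonmeager_points_subset_closure: "locally_nonmeager_points A \<subseteq> closure A"
proof
  fix x assume x: "x \<in> locally_nonmeager_points A"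
  show "x \<in> closure A"
  proof (rule ccontr)
    assume "x \<notin> closure A"
    then have "\<not> meager (A \<inter> - closure A)"
      using x unfolding locally_nonmeager_points_def by blast
    moreover have "A \<inter> - closure A = {}" using closure_subset by blast
    ultimately show False by (simp add: meager_in_empty)
  qed
qed

text \<open>Banach's category theorem in the second countable case: the exceptional points are
  covered by countably many basic open sets, each meeting \<open>A\<close> in a meager set.\<close>

lemma meager_diff_locally_nonmeager_points:
  fixes A :: "'a::topological_space set" and B :: "'a set set"
  assumes B: "countable B" "topological_basis B"
  shows "meager (A - locally_nonmeager_points A)"
proof (rule ccontr)
  assume "\<not> meager (A - locally_nonmeager_points A)"
  then have nm: "\<not> meager (A \<inter> - locally_nonmeager_points A)" by (simp add: Diff_eq)
  define B' where "B' = {U \<in> B. meager (A \<inter> U)}"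
  have "- locally_nonmeager_points A \<subseteq> \<Union>B'"
  proof
    fix x assume "x \<in> - locally_nonmeager_points A"
    then obtain U where U: "open U" "x \<in> U" "meager (A \<inter> U)"
      unfolding locally_nonmeager_points_def by blast
    then obtain V where V: "V \<in> B" "x \<in> V" "V \<subseteq> U" using topological_basisE[OF B(2)] by metis
    then have "meager (A \<inter> V)" using U(3) by (meson meager_in_subset Int_mono order_refl)
    then show "x \<in> \<Union>B'" using V unfolding B'_def by blast
  qed
  moreover have "meager (\<Union>U\<in>B'. A \<inter> U)"
    using B(1) unfolding B'_def by (intro meager_in_UN) auto
  ultimately have "meager (A \<inter> - locally_nonmeager_points A)"
    by (elim meager_in_subset) auto
  then show False using nm by blast
qed

text \<open>Off the closure of \<open>G\<close> every \<open>A n\<close> lies in the meager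
  remainders \<open>A n - ?D n\<close> and \<open>?D n - interior (?D n)\<close>. An open piece of
  \<open>?C\<close> there would meet the union in a meager set, against local nonmeagerness. What is
  left consists of boundaries.\<close>

lemma meager_locally_nonmeager_points_UN:
  fixes A :: "nat \<Rightarrow> 'a::topological_space set" and B :: "'a set set"
  assumes B: "countable B" "topological_basis B"
  shows "meager (locally_nonmeager_points (\<Union>n. A n) - (\<Union>n. locally_nonmeager_points (A n)))"
    (is "meager (?C - (\<Union>n. ?D n))")
proof -
  define G where "G = (\<Union>n. interior (?D n))"
  define Q where "Q = interior ?C \<inter> - closure G"
  have "Q = {}"
  proof (rule ccontr)
    assume "Q \<noteq> {}"
    then obtain x where x: "x \<in> Q" by blast
    have "meager (\<Union>n. (A n - ?D n) \<union> (?D n - interior (?D n)))"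
      by (intro meager_in_UN_nat meager_in_Un meager_diff_locally_nonmeager_points[OF B]
          meager_closed_diff_interior closed_locally_nonmeager_points)
    then have "meager ((\<Union>n. A n) \<inter> Q)"
      by (rule meager_in_subset) (use closure_subset[of G] in \<open>auto simp: Q_def G_def\<close>)
    moreover have "open Q" unfolding Q_def by auto
    moreover have "x \<in> ?C" using x interior_subset unfolding Q_def by blast
    ultimately show False using x unfolding locally_nonmeager_points_def by blast
  qed
  have "open G" unfolding G_def by auto
  have "meager (- G - interior (- G))" using \<open>open G\<close> by (intro meager_closed_diff_interior) auto
  moreover have "meager (?C - interior ?C)"
    by (intro meager_closed_diff_interior closed_locally_nonmeager_points)
  ultimately have "meager ((- G - interior (- G)) \<union> (?C - interior ?C))" by (rule meager_in_Un[rotated, rotated])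
  then show ?thesis
  proof (rule meager_in_subset)
    show "?C - (\<Union>n. ?D n) \<subseteq> (- G - interior (- G)) \<union> (?C - interior ?C)"
    proof
      fix x assume x: "x \<in> ?C - (\<Union>n. ?D n)"
      then have "x \<notin> G" unfolding G_def using interior_subset by blast
      moreover have "x \<notin> interior (- G) \<or> x \<notin> interior ?C"
        using \<open>Q = {}\<close> unfolding Q_def by (auto simp: interior_complement)
      ultimately show "x \<in> (- G - interior (- G)) \<union> (?C - interior ?C)" using x by blast
    qed
  qed
qed

lemma open_fun_nat_prefix_nbhd:
  fixes U :: "(nat \<Rightarrow> 'b::topological_space) set"
  assumes "open U" "z \<in> U"
  obtains n where "\<And>w. (\<And>i. i < n \<Longrightarrow> w i = z i) \<Longrightarrow> w \<in> U"
proof -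
  have "openin (product_topology (\<lambda>i. euclidean) UNIV) U"
    using assms(1) by (simp add: open_fun_def)
  then obtain X where X: "z \<in> (\<Pi>\<^sub>E i\<in>UNIV. X i)" "finite {i. X i \<noteq> UNIV}" "(\<Pi>\<^sub>E i\<in>UNIV. X i) \<subseteq> U"
    using product_topology_open_contains_basis[of "\<lambda>i. euclidean" UNIV U z] assms(2) by auto
  obtain n where n: "\<And>i. X i \<noteq> UNIV \<Longrightarrow> i < n"
    using X(2) unfolding finite_nat_set_iff_bounded by auto
  have "w \<in> U" if "\<And>i. i < n \<Longrightarrow> w i = z i" for w
  proof -
    have "w i \<in> X i" for i using X(1) n[of i] that[of i] by (cases "X i = UNIV") auto
    then show ?thesis using X(3) by auto
  qed
  then show ?thesis using that by blast
qed

lemma open_fun_prefix: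
  fixes z :: "nat \<Rightarrow> 'b::discrete_topology"
  shows "open {w. \<forall>i<n. w i = z i}"
proof -
  have "open ((\<lambda>w. w i) -` {z i})" for i
    by (rule open_vimage) (auto simp: open_discrete intro: continuous_on_product_coordinates)
  then have "open (\<Inter>i\<in>{..<n}. (\<lambda>w. w i) -` {z i})" by (intro open_INT) auto
  moreover have "(\<Inter>i\<in>{..<n}. (\<lambda>w. w i) -` {z i}) = {w. \<forall>i<n. w i = z i}" by auto
  ultimately show ?thesis by simp
qed

text \<open>Nikodym's theorem for the Souslin operation. Up to a meager set, the image of a cylinder
  \<open>s\<close> is contained in the closed set \<open>D s\<close> of points at which it is locally nonmeager. Outside a
  meager set every point of \<open>D []\<close> lies in \<open>D s\<close> for all initial segments \<open>s\<close> of some branch, and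
  continuity then puts it into the image.\<close>

lemma analytic_set_baire_property:
  fixes A :: "'a::topological_space set" and B :: "'a set set"
  assumes "analytic_set A" and B: "countable B" "topological_basis B"
    and T2: "Hausdorff_space (euclidean :: 'a topology)"
  shows "A \<in> baire_property_sets euclidean"
proof (cases "A = {}")
  case True
  then show ?thesis by (simp add: meager_baire_property_sets meager_in_empty)
next
  case False
  then obtain h :: "(nat \<Rightarrow> nat) \<Rightarrow> 'a" where h: "continuous_on UNIV h" "A = range h"
    using assms(1) unfolding analytic_set_def by blast
  \<comment> \<open>A Souslin scheme indexed by finite lists, so that the exceptional set
    \<open>M\<close> is a countable union.\<close>
  define C where "C s = h ` {z. \<forall>i<length s. z i = s ! i}" for s :: "nat list"
  define D where "D s = locally_nonmeager_points (C s)" for s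
  define M where "M = (\<Union>s. D s - (\<Union>n. D (s @ [n])))"
  have C_split: "C s = (\<Union>n. C (s @ [n]))" for s
  proof -
    have "{z. \<forall>i<length s. z i = s ! i} = (\<Union>n. {z. \<forall>i<length (s @ [n]). z i = (s @ [n]) ! i})"
      by (auto simp: nth_append less_Suc_eq)
    then show ?thesis unfolding C_def by (simp add: image_UN)
  qed
  have "meager M" unfolding M_def
  proof (intro meager_in_UN)
    fix s :: "nat list"
    show "meager (D s - (\<Union>n. D (s @ [n])))"
      unfolding D_def using meager_locally_nonmeager_points_UN[OF B, of "\<lambda>n. C (s @ [n])"] C_split[of s] by simp
  qed auto
  have "D [] - M \<subseteq> A"
  proof
    fix x assume x: "x \<in> D [] - M"
    have step: "\<exists>n. x \<in> D (s @ [n])" if "x \<in> D s" for s using x that unfolding M_def by blast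
    define t where "t = rec_nat [] (\<lambda>_ s. s @ [SOME n. x \<in> D (s @ [n])])"
    have t0: "t 0 = []" and tS: "t (Suc k) = t k @ [SOME n. x \<in> D (t k @ [n])]" for k
      unfolding t_def by auto
    have tD: "x \<in> D (t k)" for k
    proof (induction k)
      case (Suc k) then show ?case using step[of "t k"] unfolding tS by (metis someI)
    qed (use x t0 in auto)
    have len: "length (t k) = k" for k by (induction k) (auto simp: t0 tS)
    define z where "z k = t (Suc k) ! k" for k
    have t_nth: "t k ! i = z i" if "i < k" for i k
      using that
    proof (induction k)
      case (Suc k)
      show ?case
      proof (cases "i = k")
        case False
        with Suc have "i < k" by simp
        with Suc len show ?thesis by (simp add: tS nth_append)
      qed (simp add: z_def)
    qed simp
    \<comment> \<open>By continuity the images \<open>C (t n)\<close> shrink to \<open>h z\<close>,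
      while \<open>x\<close> stays in all their closures.\<close>
    have "x = h z"
    proof (rule ccontr)
      assume "x \<noteq> h z"
      then obtain U V where UV: "open U" "open V" "x \<in> U" "h z \<in> V" "U \<inter> V = {}"
        using T2 unfolding Hausdorff_space_def disjnt_def by (metis UNIV_I open_openin topspace_euclidean)
      have "open (h -` V)" using h(1) UV(2) by (simp add: continuous_on_open_vimage)
      then obtain n where n: "\<And>w. (\<And>i. i < n \<Longrightarrow> w i = z i) \<Longrightarrow> h w \<in> V"
        using open_fun_nat_prefix_nbhd[of "h -` V" z] UV(4) by auto
      have "C (t n) \<subseteq> V" unfolding C_def using n t_nth len by auto
      moreover have "x \<in> closure (C (t n))"
        using tD[of n] locally_nonmeager_points_subset_closure unfolding D_def by blast
      ultimately show False
        using UV(1,3,5) open_Int_closure_eq_empty[OF UV(1), of "C (t n)"] by blast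
    qed
    then show "x \<in> A" using h(2) by auto
  qed
  moreover have "C [] = A" unfolding C_def h(2) by auto
  then have "meager (A - D [])" unfolding D_def using meager_diff_locally_nonmeager_points[OF B] by metis
  \<comment> \<open>Only the part of \<open>M\<close> outside \<open>A\<close> is removed, so that
    \<open>A\<close> is exactly a closed set corrected by two meager sets.\<close>
  ultimately have eq: "A = (D [] - M \<inter> - A) \<union> (A - D [])" and m: "meager (M \<inter> - A)" "meager (A - D [])"
    using meager_in_subset[OF \<open>meager M\<close>] by auto
  have "D [] \<in> baire_property_sets euclidean"
    using baire_property_sets_compl[OF open_baire_property_sets[of "- D []"]]
      closed_locally_nonmeager_points[of "C []"] unfolding D_def by (auto simp: closed_def)
  then have "(D [] \<inter> - (M \<inter> - A)) \<union> (A - D []) \<in> baire_property_sets euclidean"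
    by (intro baire_property_sets_Un baire_property_sets_Int
        baire_property_sets_compl[OF meager_baire_property_sets[OF m(1)]]
        meager_baire_property_sets[OF m(2)])
  moreover have "(D [] \<inter> - (M \<inter> - A)) \<union> (A - D []) = A" using eq by blast
  ultimately show ?thesis by simp
qed

section \<open>Ideals with the Baire property\<close>

text \<open>A continuous involution is a homeomorphism, hence preserves closed sets with empty
  interior.\<close>

lemma meager_involution_vimage:
  fixes g :: "'a::topological_space \<Rightarrow> 'a"
  assumes "continuous_on UNIV g" "\<And>x. g (g x) = x" "meager N"
  shows "meager (g -` N)"
proof -
  obtain F :: "nat \<Rightarrow> 'a set" where F: "\<And>n. closed (F n)" "\<And>n. interior (F n) = {}" "N \<subseteq> (\<Union>n. F n)"
    using meager_closed_incseq assms(3) by metis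
  have "nowhere_dense_in euclidean (g -` F n)" for n
  proof -
    have "closed (g -` F n)" using F(1) assms(1) by (simp add: closed_vimage continuous_on_eq_continuous_within)
    moreover have "interior (g -` F n) = {}"
    proof -
      have "open (g -` interior (g -` F n))" using assms(1) by (simp add: open_vimage)
      moreover have "g -` interior (g -` F n) \<subseteq> F n"
        using interior_subset[of "g -` F n"] assms(2) by force
      ultimately have "g -` interior (g -` F n) = {}" using F(2)[of n] interior_maximal by blast
      then show ?thesis using assms(2) by (metis all_not_in_conv vimageI)
    qed
    ultimately show ?thesis by (simp add: nowhere_dense_in_euclidean)
  qed
  then have "meager (\<Union>n. g -` F n)" by (intro meager_in_UN_nat nowhere_dense_in_imp_meager_in)
  then show ?thesis by (rule meager_in_subset) (use F(3) in blast)
qed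

lemma Cantor_Hausdorff: "Hausdorff_space (euclidean :: (nat \<Rightarrow> bool) topology)"
proof -
  have "Hausdorff_space (euclidean :: bool topology)"
    unfolding Hausdorff_space_def disjnt_def
  proof (intro allI impI)
    fix x y :: bool assume "x \<in> topspace euclidean \<and> y \<in> topspace euclidean \<and> x \<noteq> y"
    then show "\<exists>U V. openin euclidean U \<and> openin euclidean V \<and> x \<in> U \<and> y \<in> V \<and> U \<inter> V = {}"
      by (intro exI[of _ "{x}"] exI[of _ "{y}"]) (simp add: open_discrete)
  qed
  then show ?thesis
    by (simp add: Hausdorff_space_product_topology flip: euclidean_product_topology)
qed

lemma Cantor_open_not_meager:
  fixes U :: "(nat \<Rightarrow> bool) set"
  assumes "open U" "U \<noteq> {}"
  shows "\<not> meager U"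
proof -
  have "compact_space (euclidean :: bool topology)"
    by (simp add: compact_space_def finite_imp_compact)
  then have "compact_space (euclidean :: (nat \<Rightarrow> bool) topology)"
    by (simp add: compact_space_product_topology flip: euclidean_product_topology)
  then show ?thesis
    using assms Cantor_Hausdorff by (intro Baire_open_not_meager disjI2)
      (auto intro: compact_imp_locally_compact_space compact_Hausdorff_imp_regular_space)
qed

lemma Cantor_countable_basis:
  obtains B :: "(nat \<Rightarrow> bool) set set" where "countable B" "topological_basis B"
proof
  let ?B = "range (\<lambda>l::bool list. {w :: nat \<Rightarrow> bool. \<forall>i<length l. w i = l ! i})"
  show "countable ?B" by auto
  show "topological_basis ?B"
  proof (rule topological_basisI)
    fix U :: "(nat \<Rightarrow> bool) set" assume "U \<in> ?B"
    then obtain l where "U = {w. \<forall>i<length l. w i = l ! i}" by blast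
    then show "open U" using open_fun_prefix[of "length l" "\<lambda>i. l ! i"] by simp
  next
    fix U and z :: "nat \<Rightarrow> bool" assume "open U" "z \<in> U"
    then obtain n where "\<And>w. (\<And>i. i < n \<Longrightarrow> w i = z i) \<Longrightarrow> w \<in> U"
      using open_fun_nat_prefix_nbhd by blast
    then show "\<exists>V\<in>?B. z \<in> V \<and> V \<subseteq> U"
      by (intro bexI[of _ "{w. \<forall>i<length (map z [0..<n]). w i = map z [0..<n] ! i}"] rangeI) auto
  qed
qed

lemma mem_char_functions_iff: "c \<in> char_functions I \<longleftrightarrow> {n. c n} \<in> I"
proof
  assume "{n. c n} \<in> I"
  then show "c \<in> char_functions I"
    unfolding char_functions_def by (intro image_eqI[of _ _ "{n. c n}"]) auto
qed (auto simp: char_functions_def)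

lemma admissible_ideal_subset: "admissible_ideal I \<Longrightarrow> A \<in> I \<Longrightarrow> B \<subseteq> A \<Longrightarrow> B \<in> I"
  unfolding admissible_ideal_def by blast

text \<open>A zero-one argument: were the ideal comeager in a cylinder, flipping all coordinates
  beyond its prefix would take some member to another member, and the two together contain all but
  finitely many integers.\<close>

lemma meager_char_functions_ideal:
  assumes I: "admissible_ideal I" and BP: "char_functions I \<in> baire_property_sets euclidean"
  shows "meager (char_functions I)"
proof -
  let ?C = "char_functions I"
  obtain U where U: "open U" "meager (?C - U)" "meager (U - ?C)"
    using BP baire_property_setsE by blast
  have "U = {}"
  proof (rule ccontr)
    assume "U \<noteq> {}"
    then obtain z where "z \<in> U" by blast
    then obtain n where n: "\<And>w. (\<And>i. i < n \<Longrightarrow> w i = z i) \<Longrightarrow> w \<in> U"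
      using open_fun_nat_prefix_nbhd U(1) by blast
    define W where "W = {w. \<forall>i<n. w i = z i}"
    have W: "open W" "z \<in> W" "W \<subseteq> U"
      using open_fun_prefix[of n z] n unfolding W_def by auto
    define g :: "(nat \<Rightarrow> bool) \<Rightarrow> nat \<Rightarrow> bool" where "g c i = (if i < n then c i else \<not> c i)" for c i
    have "continuous_on UNIV (\<lambda>c. g c i)" for i
    proof (cases "i < n")
      case False
      have "continuous_on UNIV (\<lambda>b::bool. \<not> b)"
        by (simp add: continuous_on_open_vimage open_discrete)
      from continuous_on_compose2[OF this, of UNIV "\<lambda>c. c i"] show ?thesis
        using False unfolding g_def by (simp add: continuous_on_product_coordinates)
    qed (simp add: g_def continuous_on_product_coordinates)
    then have "continuous_on UNIV (\<lambda>c i. g c i)" by (rule continuous_on_coordinatewise_then_product)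
    then have g: "continuous_on UNIV g" by simp
    have gg: "g (g c) = c" for c by (rule ext) (simp add: g_def)
    have gW: "g c \<in> W" if "c \<in> W" for c using that unfolding W_def g_def by auto
    have "meager (g -` (U - ?C))" using meager_involution_vimage[OF g gg U(3)] .
    from meager_in_Un[OF this U(3)] have m: "meager (g -` (U - ?C) \<union> (U - ?C))" .
    have "\<not> W \<subseteq> g -` (U - ?C) \<union> (U - ?C)"
      using Cantor_open_not_meager[OF W(1)] W(2) meager_in_subset[OF m] by blast
    then obtain c where "c \<in> W" "c \<in> ?C" "g c \<in> ?C" using W(3) gW by auto
    then have *: "{i. c i} \<in> I" "{i. g c i} \<in> I" "{..<n} \<in> I"
      using I unfolding admissible_ideal_def by (auto simp: mem_char_functions_iff)
    have "{i. c i} \<union> {i. g c i} \<union> {..<n} = UNIV" unfolding g_def by auto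
    moreover have "{i. c i} \<union> {i. g c i} \<union> {..<n} \<in> I" using I * unfolding admissible_ideal_def by blast
    ultimately show False using I unfolding admissible_ideal_def by auto
  qed
  then show ?thesis using U(2) by simp
qed

lemma char_functions_baire_property:
  assumes "analytic_set (char_functions I) \<or> coanalytic_set (char_functions I)"
  shows "char_functions I \<in> baire_property_sets euclidean"
proof -
  obtain B :: "(nat \<Rightarrow> bool) set set" where B: "countable B" "topological_basis B"
    by (rule Cantor_countable_basis)
  note BP = analytic_set_baire_property[OF _ B Cantor_Hausdorff]
  show ?thesis
    using assms BP[of "char_functions I"] baire_property_sets_compl[OF BP[of "- char_functions I"]]
    unfolding coanalytic_set_def by auto
qed

text \<open>The block must exclude \<open>F\<close> whatever the first \<open>n\<close> bits are.
  There are finitely many such prefixes, and the pattern is lengthened once for each.\<close>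

lemma nowhere_dense_block_avoid:
  fixes F :: "(nat \<Rightarrow> bool) set"
  assumes "closed F" "interior F = {}"
  shows "\<exists>m>n. \<exists>t. \<forall>c. (\<forall>i. n \<le> i \<and> i < m \<longrightarrow> c i = t i) \<longrightarrow> c \<notin> F"
proof -
  \<comment> \<open>\<open>\<S>\<close> collects the prefixes already dealt with, coded as subsets
    of \<open>{..<n}\<close>.\<close>
  define avoids where "avoids \<S> m t \<longleftrightarrow> (\<forall>c. {i. i < n \<and> c i} \<in> \<S> \<longrightarrow>
    (\<forall>i. n \<le> i \<and> i < m \<longrightarrow> c i = t i) \<longrightarrow> c \<notin> F)" for \<S> m and t :: "nat \<Rightarrow> bool"
  have "\<exists>m>n. \<exists>t. avoids \<S> m t" if "finite \<S>" for \<S>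
    using that
  proof (induction \<S> rule: finite_induct)
    case empty
    show ?case by (rule exI[of _ "Suc n"]) (simp add: avoids_def)
  next
    case (insert S \<S>)
    then obtain m t where mt: "m > n" "avoids \<S> m t" by metis
    \<comment> \<open>The new prefix followed by the pattern so far: leaving \<open>F\<close> within
      this cylinder keeps that pattern, so earlier prefixes stay excluded.\<close>
    define z where "z i = (if i < n then i \<in> S else t i)" for i
    define W where "W = {w. \<forall>i<m. w i = z i}"
    have "open W" unfolding W_def by (rule open_fun_prefix)
    moreover have "z \<in> W" unfolding W_def by simp
    ultimately obtain w where w: "open (W - F)" "w \<in> W - F"
      using nonempty_open_Diff[OF assms(2,1), of W] by blast
    then obtain k where k: "\<And>c. (\<And>i. i < k \<Longrightarrow> c i = w i) \<Longrightarrow> c \<in> W - F"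
      using open_fun_nat_prefix_nbhd by blast
    have wz: "w i = z i" if "i < m" for i using w(2) that unfolding W_def by simp
    have "avoids (insert S \<S>) (max m k) w"
      unfolding avoids_def
    proof (intro allI impI)
      fix c
      assume pre: "{i. i < n \<and> c i} \<in> insert S \<S>"
        and block: "\<forall>i. n \<le> i \<and> i < max m k \<longrightarrow> c i = w i"
      show "c \<notin> F"
      proof (cases "{i. i < n \<and> c i} = S")
        case True
        have "c i = w i" if "i < k" for i
        proof (cases "i < n")
          case True
          then have "w i = (i \<in> S)" using wz[of i] \<open>m > n\<close> unfolding z_def by simp
          moreover have "c i = (i \<in> S)" using \<open>i < n\<close> \<open>{i. i < n \<and> c i} = S\<close> by blast
          ultimately show ?thesis by simp
        next
          case False
          then show ?thesis using that block by simp
        qed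
        then show ?thesis using k by blast
      next
        case False
        then have "{i. i < n \<and> c i} \<in> \<S>" using pre by blast
        moreover have "\<forall>i. n \<le> i \<and> i < m \<longrightarrow> c i = t i"
          using block wz unfolding z_def by (simp add: less_max_iff_disj)
        ultimately show ?thesis using mt(2) unfolding avoids_def by blast
      qed
    qed
    moreover have "max m k > n" using mt(1) by simp
    ultimately show ?case by blast
  qed
  from this[of "Pow {..<n}"] obtain m t where "m > n" "avoids (Pow {..<n}) m t" by auto
  moreover have "{i. i < n \<and> c i} \<in> Pow {..<n}" for c :: "nat \<Rightarrow> bool" by auto
  ultimately show ?thesis unfolding avoids_def by blast
qed

text \<open>The theorem of Jalali-Naini and Talagrand.\<close>

lemma ideal_baire_property_blocks:
  assumes I: "admissible_ideal I" and BP: "char_functions I \<in> baire_property_sets euclidean"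
  obtains b :: "nat \<Rightarrow> nat"
  where "strict_mono b" "\<And>A. A \<in> I \<Longrightarrow> finite {k. {b k..<b (Suc k)} \<subseteq> A}"
proof -
  obtain F :: "nat \<Rightarrow> (nat \<Rightarrow> bool) set"
    where F: "\<And>n. closed (F n)" "\<And>n. interior (F n) = {}" "incseq F" "char_functions I \<subseteq> (\<Union>n. F n)"
    using meager_closed_incseq[OF meager_char_functions_ideal[OF I BP]] by metis
  define avoids where "avoids k n m t \<longleftrightarrow>
    m > n \<and> (\<forall>c. (\<forall>i. n \<le> i \<and> i < m \<longrightarrow> c i = t i) \<longrightarrow> c \<notin> F k)" for k n m t
  have "\<exists>m t. avoids k n m t" for k n
    using nowhere_dense_block_avoid[OF F(1,2)[of k]] unfolding avoids_def by blast
  then obtain m t where "avoids k n (m k n) (t k n)" for k n by metis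
  then have mt: "m k n > n" "\<forall>i. n \<le> i \<and> i < m k n \<longrightarrow> c i = t k n i \<Longrightarrow> c \<notin> F k" for k n c
    unfolding avoids_def by blast+
  define b where "b = rec_nat 0 m"
  have bS: "b (Suc k) = m k (b k)" for k unfolding b_def by simp
  have sm: "strict_mono b" by (rule strict_monoI_Suc) (simp add: bS mt(1))
  have block_unique: "k = j" if "b k \<le> i" "i < b (Suc k)" "b j \<le> i" "i < b (Suc j)" for i j k
  proof -
    have "b k < b (Suc j)" "b j < b (Suc k)" using that by auto
    then show ?thesis using sm by (simp add: strict_mono_less)
  qed
  have "finite {k. {b k..<b (Suc k)} \<subseteq> A}" if "A \<in> I" for A
  proof (rule ccontr)
    assume inf: "infinite {k. {b k..<b (Suc k)} \<subseteq> A}"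
    \<comment> \<open>The part of \<open>A\<close> that shows the excluding pattern on every block
      contained in \<open>A\<close>. As a subset of \<open>A\<close> it is in the ideal, yet it
      leaves \<open>F k\<close> for infinitely many \<open>k\<close>.\<close>
    define c where "c i = (\<exists>k. {b k..<b (Suc k)} \<subseteq> A \<and> b k \<le> i \<and> i < b (Suc k) \<and> t k (b k) i)" for i
    have "{i. c i} \<subseteq> A" unfolding c_def by auto
    then have "c \<in> char_functions I"
      using admissible_ideal_subset[OF I \<open>A \<in> I\<close>] by (simp add: mem_char_functions_iff)
    then obtain j where j: "c \<in> F j" using F(4) by blast
    obtain k where k: "k \<ge> j" "{b k..<b (Suc k)} \<subseteq> A"
      using inf unfolding infinite_nat_iff_unbounded_le by blast
    have "c i = t k (b k) i" if "b k \<le> i" "i < m k (b k)" for i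
      unfolding c_def using that k(2) block_unique[of k i] by (metis bS)
    then have "c \<notin> F k" using mt(2)[of "b k" k c] by blast
    then show False using j k(1) F(3) unfolding incseq_def by blast
  qed
  with sm show ?thesis using that by blast
qed

section \<open>Generic sequences and permutations\<close>

lemma comeager_in_INT:
  assumes "countable J" "J \<noteq> {}" "\<And>i. i \<in> J \<Longrightarrow> comeager_in T (A i)"
  shows "comeager_in T (\<Inter>i\<in>J. A i)"
proof -
  have "meager_in T (topspace T - A i)" if "i \<in> J" for i
    using assms(3)[OF that] unfolding comeager_in_def by blast
  then have "meager_in T (\<Union>i\<in>J. topspace T - A i)"
    by (rule meager_in_UN[OF assms(1)])
  then have "meager_in T (topspace T - (\<Inter>i\<in>J. A i))"
    by (rule meager_in_subset) auto
  moreover obtain j where "j \<in> J" using assms(2) by blast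
  then have "(\<Inter>i\<in>J. A i) \<subseteq> topspace T"
    using assms(3)[of j] unfolding comeager_in_def by blast
  ultimately show ?thesis unfolding comeager_in_def by blast
qed

lemma comeager_in_superset:
  assumes "comeager_in T A" "A \<subseteq> B" "B \<subseteq> topspace T"
  shows "comeager_in T B"
  using assms(3) meager_in_subset[of T "topspace T - A" "topspace T - B"] assms(1,2)
  unfolding comeager_in_def by blast

text \<open>Relative openness (\<open>opn\<close>) and density (\<open>dns\<close>) are phrased
  through initial segments because the extension properties of \<open>S_space\<close> and
  \<open>P_space\<close> come in this form.\<close>

lemma comeager_in_prefix_dense_open:
  fixes Y :: "(nat \<Rightarrow> 'b::discrete_topology) set"
  assumes "countable J"
    and opn: "\<And>i s. i \<in> J \<Longrightarrow> s \<in> Y \<Longrightarrow> s \<in> R i \<Longrightarrow>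
      \<exists>n. \<forall>s'\<in>Y. (\<forall>k<n. s' k = s k) \<longrightarrow> s' \<in> R i"
    and dns: "\<And>i s n. i \<in> J \<Longrightarrow> s \<in> Y \<Longrightarrow> \<exists>s'\<in>Y. (\<forall>k<n. s' k = s k) \<and> s' \<in> R i"
    and sub: "\<And>s. s \<in> Y \<Longrightarrow> (\<And>i. i \<in> J \<Longrightarrow> s \<in> R i) \<Longrightarrow> s \<in> B" and "B \<subseteq> Y"
  shows "comeager_in (top_of_set Y) B"
proof -
  have "nowhere_dense_in (top_of_set Y) (Y - R i)" if i: "i \<in> J" for i
  proof -
    have "openin (top_of_set Y) (Y \<inter> R i)"
    proof (subst openin_subopen, intro ballI)
      fix s assume s: "s \<in> Y \<inter> R i"
      then obtain n where "\<forall>s'\<in>Y. (\<forall>k<n. s' k = s k) \<longrightarrow> s' \<in> R i"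
        using opn i by blast
      then show "\<exists>T. openin (top_of_set Y) T \<and> s \<in> T \<and> T \<subseteq> Y \<inter> R i"
        using s open_fun_prefix[of n s]
        by (intro exI[of _ "Y \<inter> {w. \<forall>k<n. w k = s k}"]) auto
    qed
    then have "closedin (top_of_set Y) (Y - R i)"
      unfolding closedin_def by (simp add: Diff_Diff_Int)
    then have "top_of_set Y closure_of (Y - R i) = Y - R i" by (simp add: closure_of_closedin)
    moreover have "top_of_set Y interior_of (Y - R i) = {}"
    proof (rule ccontr)
      assume "top_of_set Y interior_of (Y - R i) \<noteq> {}"
      then obtain s W where W: "openin (top_of_set Y) W" "W \<subseteq> Y - R i" "s \<in> W"
        using openin_interior_of interior_of_subset by (metis ex_in_conv)
      then obtain U where U: "open U" "W = Y \<inter> U" by (metis openin_open)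
      then obtain n where n: "\<And>w. (\<And>i. i < n \<Longrightarrow> w i = s i) \<Longrightarrow> w \<in> U"
        using open_fun_nat_prefix_nbhd W(3) by blast
      have "s \<in> Y" using W by blast
      then obtain s' where "s' \<in> Y" "\<forall>k<n. s' k = s k" "s' \<in> R i" using dns i by blast
      then show False using W(2) U(2) n[of s'] by blast
    qed
    ultimately show ?thesis unfolding nowhere_dense_in_def by simp
  qed
  then have "meager_in (top_of_set Y) (\<Union>i\<in>J. Y - R i)"
    using assms(1) by (intro meager_in_UN nowhere_dense_in_imp_meager_in)
  then have "meager_in (top_of_set Y) (Y - B)"
    by (rule meager_in_subset) (use sub in blast)
  then show ?thesis unfolding comeager_in_def using \<open>B \<subseteq> Y\<close> by simp
qed

text \<open>This replaces an application of the Kuratowski--Ulam theorem: only the sections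
  \<open>D m\<close> need the Baire property, and no measurability in the product space is involved.\<close>

lemma comeager_block_capture:
  fixes D :: "nat \<Rightarrow> 'x::second_countable_topology set" and Y :: "(nat \<Rightarrow> nat) set"
  assumes ext: "\<And>s N M A. s \<in> Y \<Longrightarrow> infinite A \<Longrightarrow>
      \<exists>s'\<in>Y. (\<forall>i<N. s' i = s i) \<and> (\<forall>i. N \<le> i \<and> i < M \<longrightarrow> s' i \<in> A)"
    and D: "\<And>m. D m \<in> baire_property_sets euclidean"
    and E: "\<And>x. x \<in> E \<Longrightarrow> infinite {m. x \<in> D m}"
    and b: "strict_mono b"
  shows "comeager_in (top_of_set Y)
    {s \<in> Y. meager {x \<in> E. \<not> (\<exists>k\<ge>K. \<forall>i\<in>{b k..<b (Suc k)}. x \<in> D (s i))}}"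
proof -
  obtain \<B> :: "'x set set" where \<B>: "countable \<B>" "topological_basis \<B>"
    using ex_countable_basis by blast
  define H where "H s k = (\<Inter>i\<in>{b k..<b (Suc k)}. D (s i))" for s k
  define J where "J = {U \<in> \<B>. \<not> meager (E \<inter> U)}"
  \<comment> \<open>Membership in \<open>R U\<close> is witnessed by finitely many values of
    \<open>s\<close>, hence an open condition: some block captures a nonmeager part of
    \<open>U\<close>.\<close>
  define R where "R U = {s. \<exists>k\<ge>K. \<not> meager (H s k \<inter> U)}" for U
  have bk: "k \<le> b k" for k using b by (simp add: strict_mono_imp_increasing)
  show ?thesis
  proof (rule comeager_in_prefix_dense_open[of J Y R])
    show "countable J" unfolding J_def using \<B>(1) by auto
  next
    fix U s assume "U \<in> J" "s \<in> Y" "s \<in> R U"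
    then obtain k where k: "k \<ge> K" "\<not> meager (H s k \<inter> U)" unfolding R_def by blast
    have "s' \<in> R U" if "\<forall>i<b (Suc k). s' i = s i" for s'
    proof -
      have "H s' k = H s k" using that unfolding H_def by auto
      then show ?thesis using k unfolding R_def by auto
    qed
    then show "\<exists>n. \<forall>s'\<in>Y. (\<forall>k<n. s' k = s k) \<longrightarrow> s' \<in> R U" by blast
  next
    fix U s n assume U: "U \<in> J" and s: "s \<in> Y"
    \<comment> \<open>Since \<open>k \<le> b k\<close>, block \<open>k\<close> starts behind the
      prescribed first \<open>n\<close> values.\<close>
    define k where "k = max K n"
    \<comment> \<open>The continuation that captures \<open>x\<close> matters only through its list
      \<open>l\<close> of values. One of the countably many \<open>W l\<close> is nonmeager, and any
      continuation with that list captures all of it.\<close>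
    define W where "W l = {x \<in> E \<inter> U. \<exists>s'\<in>Y. (\<forall>i<b k. s' i = s i) \<and> map s' [0..<b (Suc k)] = l \<and> x \<in> H s' k}" for l
    have "E \<inter> U \<subseteq> (\<Union>l. W l)"
    proof
      fix x assume x: "x \<in> E \<inter> U"
      then obtain s' where "s' \<in> Y" "\<forall>i<b k. s' i = s i" "\<forall>i. b k \<le> i \<and> i < b (Suc k) \<longrightarrow> s' i \<in> {m. x \<in> D m}"
        using ext[OF s E, of x "b k" "b (Suc k)"] by blast
      then have "x \<in> W (map s' [0..<b (Suc k)])" using x unfolding W_def H_def by auto
      then show "x \<in> (\<Union>l. W l)" by blast
    qed
    then have "\<not> meager (\<Union>l. W l)" using U meager_in_subset unfolding J_def by blast
    then obtain l where l: "\<not> meager (W l)"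
      using meager_in_UN[of UNIV euclidean W] by auto
    then have "W l \<noteq> {}" using meager_in_empty by metis
    then obtain s' where s': "s' \<in> Y" "\<forall>i<b k. s' i = s i" "map s' [0..<b (Suc k)] = l"
      unfolding W_def by blast
    have "W l \<subseteq> H s' k \<inter> U"
    proof
      fix x assume "x \<in> W l"
      then obtain s'' where s'': "x \<in> U" "map s'' [0..<b (Suc k)] = l" "x \<in> H s'' k" unfolding W_def by blast
      then have "\<forall>i<b (Suc k). s'' i = s' i" using s'(3) by auto
      then have "H s'' k = H s' k" unfolding H_def by auto
      then show "x \<in> H s' k \<inter> U" using s'' by auto
    qed
    then have "\<not> meager (H s' k \<inter> U)" using l meager_in_subset by blast
    moreover have "k \<ge> K" unfolding k_def by simp
    ultimately have "s' \<in> R U" unfolding R_def by blast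
    moreover have "n \<le> b k" using bk[of k] unfolding k_def by linarith
    then have "\<forall>i<n. s' i = s i" using s'(2) by simp
    ultimately show "\<exists>s'\<in>Y. (\<forall>i<n. s' i = s i) \<and> s' \<in> R U" using s'(1) by blast
  next
    fix s assume s: "s \<in> Y" "\<And>U. U \<in> J \<Longrightarrow> s \<in> R U"
    \<comment> \<open>The uncaptured points. If they were nonmeager in \<open>E\<close>, they would
      be comeager in a basic \<open>U\<close> belonging to \<open>J\<close>, against the nonmeager
      capture in \<open>U\<close> granted by \<open>R U\<close>.\<close>
    define A where "A = (\<Inter>k\<in>{K..}. - H s k)"
    have BP: "A \<in> baire_property_sets euclidean" unfolding A_def H_def
      by (intro baire_property_sets_INT baire_property_sets_compl D) auto
    have "meager (A \<inter> E)"
    proof (rule ccontr)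
      assume "\<not> meager (A \<inter> E)"
      then obtain U where U: "U \<in> \<B>" "\<not> meager (A \<inter> E \<inter> U)" "meager (U - A)"
        using baire_property_sets_comeager_in_open[OF BP \<B>] by blast
      have "\<not> meager (E \<inter> U)" using U(2) meager_in_subset[of euclidean "E \<inter> U" "A \<inter> E \<inter> U"] by auto
      then obtain k where "k \<ge> K" "\<not> meager (H s k \<inter> U)" using s(2)[of U] U(1) unfolding J_def R_def by blast
      moreover have "H s k \<inter> U \<subseteq> U - A" using \<open>k \<ge> K\<close> unfolding A_def by auto
      ultimately show False using U(3) meager_in_subset by blast
    qed
    moreover have "{x \<in> E. \<not> (\<exists>k\<ge>K. \<forall>i\<in>{b k..<b (Suc k)}. x \<in> D (s i))} = A \<inter> E"
      unfolding A_def H_def by auto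
    ultimately show "s \<in> {s \<in> Y. meager {x \<in> E. \<not> (\<exists>k\<ge>K. \<forall>i\<in>{b k..<b (Suc k)}. x \<in> D (s i))}}"
      using s(1) by simp
  qed auto
qed

section \<open>Continuing finite initial segments in \<open>S_space\<close> and
  \<open>P_space\<close>\<close>

lemma S_space_extension:
  assumes "s \<in> S_space" "infinite A"
  shows "\<exists>s'\<in>S_space. (\<forall>i<N. s' i = s i) \<and> (\<forall>i. N \<le> i \<and> i < M \<longrightarrow> s' i \<in> A)"
proof -
  \<comment> \<open>Values above \<open>s N\<close> exceed all kept values, and \<open>N = 0\<close>
    is covered as well.\<close>
  define A' where "A' = A - {..s N}"
  have inf: "infinite A'" unfolding A'_def using assms(2) by simp
  define s' where "s' i = (if i < N then s i else enumerate A' (i - N))" for i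
  have mem: "enumerate A' i \<in> A" "s N < enumerate A' i" for i
    using enumerate_in_set[OF inf, of i] unfolding A'_def by auto
  have "s' i < s' (Suc i)" for i
  proof (cases "Suc i" N rule: linorder_cases)
    case equal
    then have "s i < s N" using assms(1) unfolding S_space_def by auto
    then show ?thesis using equal mem(2)[of 0] unfolding s'_def by auto
  next
    case greater
    then have "Suc i - N = Suc (i - N)" by simp
    then show ?thesis using greater enumerate_step[OF inf, of "i - N"] unfolding s'_def by auto
  qed (use assms(1) in \<open>auto simp: S_space_def s'_def\<close>)
  then have "s' \<in> S_space" unfolding S_space_def by auto
  then show ?thesis using mem by (intro bexI[of _ s']) (auto simp: s'_def)
qed

text \<open>Infinitely many arguments and infinitely many values remain; they are matched through
  their enumerations.\<close>

lemma inj_on_extend_bij: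
  fixes t :: "nat \<Rightarrow> nat"
  assumes "inj_on t {..<M}"
  obtains s where "bij s" "\<And>i. i < M \<Longrightarrow> s i = t i"
proof -
  have inf: "infinite (- {..<M})" "infinite (- t ` {..<M})"
    by (simp_all only: Compl_eq_Diff_UNIV Diff_infinite_finite finite_imageI finite_lessThan infinite_UNIV_nat not_False_eq_True)
  obtain g where "bij_betw g (- {..<M}) (UNIV :: nat set)"
    using bij_betw_inv[OF bij_enumerate[OF inf(1)]] by blast
  moreover obtain h where "bij_betw h (UNIV :: nat set) (- t ` {..<M})"
    using bij_enumerate[OF inf(2)] by blast
  ultimately
  have g: "bij_betw (h \<circ> g) (- {..<M}) (- t ` {..<M})" by (rule bij_betw_trans)
  define s where "s i = (if i \<in> {..<M} then t i else (h \<circ> g) i)" for i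
  have "bij_betw s {..<M} (t ` {..<M})"
    using inj_on_imp_bij_betw[OF assms] by (subst bij_betw_cong[of _ s t]) (auto simp: s_def)
  moreover have "bij_betw s (- {..<M}) (- t ` {..<M})"
    using g by (subst bij_betw_cong[of _ s "h \<circ> g"]) (auto simp: s_def)
  ultimately have "bij_betw s ({..<M} \<union> - {..<M}) (t ` {..<M} \<union> - t ` {..<M})"
    by (rule bij_betw_combine) auto
  then have "bij s" by (simp only: Compl_partition)
  then show ?thesis using that unfolding s_def by auto
qed

lemma P_space_extension:
  assumes "s \<in> P_space" "infinite A"
  shows "\<exists>s'\<in>P_space. (\<forall>i<N. s' i = s i) \<and> (\<forall>i. N \<le> i \<and> i < M \<longrightarrow> s' i \<in> A)"
proof -
  define A' where "A' = A - s ` {..<N}"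
  have inf: "infinite A'" unfolding A'_def using assms(2) by simp
  define t where "t i = (if i < N then s i else enumerate A' (i - N))" for i
  have mem: "enumerate A' i \<in> A" "enumerate A' i \<notin> s ` {..<N}" for i
    using enumerate_in_set[OF inf, of i] unfolding A'_def by auto
  have "inj s" using assms(1) unfolding P_space_def by (simp add: bij_is_inj)
  have "inj t"
  proof (rule linorder_injI)
    fix i j :: nat assume "i < j"
    consider "j < N" | "i < N" "N \<le> j" | "N \<le> i" by linarith
    then show "t i \<noteq> t j"
    proof cases
      case 1
      then show ?thesis using \<open>i < j\<close> injD[OF \<open>inj s\<close>, of i j] unfolding t_def by auto
    next
      case 2
      then have "t i \<in> s ` {..<N}" unfolding t_def by auto
      moreover have "t j \<notin> s ` {..<N}" using 2 mem(2) unfolding t_def by simp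
      ultimately show ?thesis by metis
    next
      case 3
      then have "i - N \<noteq> j - N" using \<open>i < j\<close> by simp
      then show ?thesis
        using 3 \<open>i < j\<close> injD[OF inj_enumerate[OF inf], of "i - N" "j - N"] unfolding t_def by auto
    qed
  qed
  \<comment> \<open>The maximum takes care of \<open>M < N\<close>, where the first \<open>N\<close>
    values must still be kept.\<close>
  then have "inj_on t {..<max N M}" by (rule inj_on_subset) simp
  then obtain s' where s': "bij s'" "\<And>i. i < max N M \<Longrightarrow> s' i = t i"
    using inj_on_extend_bij by blast
  show ?thesis
  proof (intro bexI[of _ s'] conjI allI impI)
    show "s' i = s i" if "i < N" for i using s'(2)[of i] that unfolding t_def by simp
    show "s' i \<in> A" if "N \<le> i \<and> i < M" for i using s'(2)[of i] that mem(1) unfolding t_def by simp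
    show "s' \<in> P_space" using s'(1) unfolding P_space_def by simp
  qed
qed

section \<open>Partitions into meager sets\<close>

text \<open>The two points are built by a fusion in which they take turns: while one of them is kept in
  \<open>P i\<close> for a block of indices \<open>i\<close>, the other one is shrunk, and the block is prolonged until the
  next one may start for the shrunken neighbourhood.\<close>

lemma fusion_two_points:
  fixes P :: "nat \<Rightarrow> 'x::complete_space set"
  assumes P: "\<And>i. open (P i)" and W0: "open W0" "W0 \<noteq> {}"
    and good: "\<And>U. open U \<Longrightarrow> U \<noteq> {} \<Longrightarrow> U \<subseteq> W0 \<Longrightarrow>
      \<exists>m. \<forall>m'. U \<inter> (\<Inter>i\<in>{m..<m'}. P i) \<noteq> {}"
    and M: "meager M"
  obtains x y i0 where "x \<in> W0 - M" "y \<in> W0 - M" "\<And>i. i \<ge> i0 \<Longrightarrow> x \<in> P i \<or> y \<in> P i"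
proof -
  obtain F :: "nat \<Rightarrow> 'x set"
    where F: "\<And>n. closed (F n)" "\<And>n. interior (F n) = {}" "incseq F" "M \<subseteq> (\<Union>n. F n)"
    using meager_closed_incseq[OF M] by metis
  define nbhd where "nbhd U \<longleftrightarrow> open U \<and> U \<noteq> {} \<and> U \<subseteq> W0" for U
  define good_from where "good_from U m \<longleftrightarrow> (\<forall>m'. U \<inter> (\<Inter>i\<in>{m..<m'}. P i) \<noteq> {})" for U m
  have good_from_mono: "good_from U m'" if "good_from U m" "m \<le> m'" for U m m'
    unfolding good_from_def
  proof
    fix m''
    have "U \<inter> (\<Inter>i\<in>{m..<m''}. P i) \<subseteq> U \<inter> (\<Inter>i\<in>{m'..<m''}. P i)" using that(2) by auto
    then show "U \<inter> (\<Inter>i\<in>{m'..<m''}. P i) \<noteq> {}"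
      using that(1) unfolding good_from_def by blast
  qed
  have shrink: "\<exists>V m'. nbhd V \<and> closure V \<subseteq> U \<and> V \<inter> F n = {} \<and> V \<subseteq> ball v (inverse (Suc n))
      \<and> m < m' \<and> good_from V m'"
    if U: "nbhd U" and v: "v \<in> U - F n" for U v n m
  proof -
    have "open (U - F n)" using U F(1) unfolding nbhd_def by (auto intro: open_Diff)
    then obtain e where e: "e > 0" "cball v e \<subseteq> U - F n" using v open_contains_cball by blast
    define V where "V = ball v (min e (inverse (Suc n)))"
    have sub: "closure V \<subseteq> cball v e" unfolding V_def
      by (rule closure_minimal) auto
    have "v \<in> V" using e(1) unfolding V_def by (simp only: centre_in_ball) (simp add: min_def)
    moreover have "open V" unfolding V_def by simp
    moreover have "V \<subseteq> W0" using e(2) sub closure_subset[of V] U unfolding nbhd_def by blast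
    ultimately have "nbhd V" unfolding nbhd_def by blast
    moreover have "closure V \<subseteq> U" "V \<inter> F n = {}" using sub e(2) closure_subset[of V] by auto
    moreover have "V \<subseteq> ball v (inverse (Suc n))" unfolding V_def by auto
    moreover obtain k where "good_from V k"
      using good[of V] \<open>nbhd V\<close> unfolding nbhd_def good_from_def by blast
    \<comment> \<open>\<open>Suc m\<close> makes every block nonempty, so the blocks exhaust all
      indices from \<open>m 0\<close> on.\<close>
    then have "good_from V (max k (Suc m))" by (rule good_from_mono) simp
    ultimately show ?thesis by (intro exI[of _ V] exI[of _ "max k (Suc m)"]) auto
  qed
  \<comment> \<open>\<open>V\<close> can meet the \<open>P i\<close> over any finite interval
    starting at \<open>m\<close>, while \<open>U\<close> is due for shrinking. Each step exchanges
    the roles: one point is the limit of the even \<open>V n\<close>, the other of the odd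
    ones.\<close>
  define st where "st n = (\<lambda>(U, V, m). nbhd U \<and> nbhd V \<and> good_from V m)" for n :: nat
  define next_st where "next_st n = (\<lambda>(U, V, m) (U', V', m'). m < m' \<and>
      U' = V \<inter> (\<Inter>i\<in>{m..<m'}. P i) \<and> closure V' \<subseteq> U \<and> V' \<inter> F n = {} \<and>
      (\<exists>v. V' \<subseteq> ball v (inverse (Suc n))))" for n
  have "\<exists>f. \<forall>n. st n (f n) \<and> next_st n (f n) (f (Suc n))"
  proof (rule dependent_nat_choice)
    obtain m where "good_from W0 m" using good[of W0] W0 unfolding good_from_def by blast
    then show "\<exists>x. st 0 x" using W0 unfolding st_def nbhd_def by auto
  next
    fix x n assume "st n x"
    then obtain U V m where x: "x = (U, V, m)" "nbhd U" "nbhd V" "good_from V m"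
      unfolding st_def by (cases x) auto
    have "U - F n \<noteq> {}" using nonempty_open_Diff(2)[OF F(2,1)] x(2) unfolding nbhd_def by blast
    then obtain v where "v \<in> U - F n" by blast
    then obtain V' m' where V': "nbhd V'" "closure V' \<subseteq> U" "V' \<inter> F n = {}"
        "V' \<subseteq> ball v (inverse (Suc n))" "m < m'" "good_from V' m'"
      using shrink[OF x(2)] by blast
    define U' where "U' = V \<inter> (\<Inter>i\<in>{m..<m'}. P i)"
    have "open U'" using x(3) P unfolding nbhd_def U'_def by (intro open_Int open_INT) auto
    moreover have "U' \<noteq> {}" using x(4) unfolding good_from_def U'_def by blast
    moreover have "U' \<subseteq> W0" using x(3) unfolding nbhd_def U'_def by blast
    ultimately have "nbhd U'" unfolding nbhd_def by blast
    then have "st (Suc n) (U', V', m') \<and> next_st n x (U', V', m')"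
      using V' unfolding st_def next_st_def x(1) U'_def by auto
    then show "\<exists>y. st (Suc n) y \<and> next_st n x y" by blast
  qed
  then obtain f where f: "\<And>n. st n (f n)" "\<And>n. next_st n (f n) (f (Suc n))" by blast
  define U where "U n = fst (f n)" for n
  define V where "V n = fst (snd (f n))" for n
  define m where "m n = snd (snd (f n))" for n
  have fn: "f n = (U n, V n, m n)" for n unfolding U_def V_def m_def by simp
  have V: "nbhd (V n)" for n using f(1)[of n] unfolding fn st_def by simp
  have step: "m n < m (Suc n)" "U (Suc n) = V n \<inter> (\<Inter>i\<in>{m n..<m (Suc n)}. P i)"
    "closure (V (Suc n)) \<subseteq> U n" "V (Suc n) \<inter> F n = {}"
    "\<exists>v. V (Suc n) \<subseteq> ball v (inverse (Suc n))" for n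
    using f(2)[of n] unfolding fn next_st_def by auto
  have VV: "closure (V (Suc (Suc n))) \<subseteq> V n \<inter> (\<Inter>i\<in>{m n..<m (Suc n)}. P i)" for n
    using step(2)[of n] step(3)[of "Suc n"] by simp
  have limit: "\<exists>x. \<forall>n. x \<in> V (2 * n + p)" for p
  proof -
    define C where "C n = closure (V (2 * n + p))" for n
    have C_Suc: "C (Suc n) \<subseteq> V (2 * n + p)" for n using VV[of "2 * n + p"] unfolding C_def by auto
    have "\<exists>x. \<forall>n. x \<in> C n"
    proof (rule decreasing_closed_nest[of C])
      show "closed (C n)" for n unfolding C_def by simp
      show "C n \<noteq> {}" for n using V unfolding C_def nbhd_def by simp
      have "C (Suc n) \<subseteq> C n" for n using C_Suc[of n] closure_subset unfolding C_def by blast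
      then show "C n \<subseteq> C k" if "k \<le> n" for k n using that by (rule lift_Suc_antimono_le)
      show "\<exists>n. \<forall>x\<in>C n. \<forall>y\<in>C n. dist x y < \<epsilon>" if eps: "\<epsilon> > 0" for \<epsilon> :: real
      proof -
        obtain N where N: "inverse (real (Suc N)) < \<epsilon> / 2"
          using reals_Archimedean[of "\<epsilon> / 2"] eps by auto
        \<comment> \<open>The radius bound speaks of \<open>V (Suc k)\<close>, so
          \<open>Suc k\<close> is the index of the form \<open>2 * n + p\<close>.\<close>
        define k where "k = 2 * Suc N + p - 1"
        have k: "Suc k = 2 * Suc N + p" "k \<ge> N" unfolding k_def by auto
        obtain v where v: "V (Suc k) \<subseteq> ball v (inverse (Suc k))" using step(5) by blast
        have "inverse (real (Suc k)) \<le> inverse (real (Suc N))" using k(2) by simp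
        then have "inverse (real (Suc k)) \<le> \<epsilon> / 2" using N by linarith
        then have "V (Suc k) \<subseteq> ball v (\<epsilon> / 2)" using v subset_ball by blast
        then have "C (Suc (Suc N)) \<subseteq> ball v (\<epsilon> / 2)" using C_Suc[of "Suc N"] unfolding k(1) by blast
        then have "dist x y < \<epsilon>" if "x \<in> C (Suc (Suc N))" "y \<in> C (Suc (Suc N))" for x y
          using that dist_triangle_half_r[of v x \<epsilon> y] by (auto simp: subset_iff)
        then show ?thesis by blast
      qed
    qed blast
    then show ?thesis using C_Suc by blast
  qed
  obtain x y where x: "\<And>n. x \<in> V (2 * n + 0)" and y: "\<And>n. y \<in> V (2 * n + 1)"
    using limit[of 0] limit[of 1] by blast
  have outside: "z \<in> W0 - M" if z: "\<And>n. z \<in> V (2 * n + p)" for z p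
  proof -
    have "z \<notin> F n" for n
    proof -
      have "Suc (2 * n + p + 1) = 2 * Suc n + p" by simp
      then have "z \<notin> F (2 * n + p + 1)" using step(4)[of "2 * n + p + 1"] z[of "Suc n"] by auto
      moreover have "F n \<subseteq> F (2 * n + p + 1)" using F(3) unfolding incseq_def by simp
      ultimately show ?thesis by blast
    qed
    moreover have "z \<in> W0" using z[of 0] V unfolding nbhd_def by blast
    ultimately show ?thesis using F(4) by blast
  qed
  have sm: "strict_mono m" by (rule strict_monoI_Suc) (rule step(1))
  have "x \<in> P i \<or> y \<in> P i" if i: "i \<ge> m 0" for i
  proof -
    have ex: "\<exists>n. i < m n" using strict_mono_imp_increasing[OF sm, of "Suc i"] by (intro exI[of _ "Suc i"]) simp
    \<comment> \<open>This locates \<open>i\<close> in the block from \<open>m k\<close> to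
      \<open>m (Suc k)\<close>, for which \<open>V k\<close> was cut down to \<open>P i\<close>; the
      limit point with the parity of \<open>k\<close> stays inside.\<close>
    define n where "n = (LEAST n. i < m n)"
    have "i < m n" unfolding n_def using ex by (rule LeastI_ex)
    moreover have "n \<noteq> 0" using \<open>i < m n\<close> i by (metis linorder_not_less)
    then obtain k where k: "n = Suc k" using not0_implies_Suc by blast
    have "\<not> i < m k" using not_less_Least[of k "\<lambda>n. i < m n"] k unfolding n_def by simp
    ultimately have "V (Suc (Suc k)) \<subseteq> P i" using VV[of k] closure_subset k by fastforce
    moreover have "x \<in> V (Suc (Suc k)) \<or> y \<in> V (Suc (Suc k))"
    proof (cases "even k")
      case True
      then obtain j where "k = 2 * j" by blast
      then show ?thesis using x[of "Suc j"] by simp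
    next
      case False
      then obtain j where "k = 2 * j + 1" using oddE by blast
      then show ?thesis using y[of "Suc j"] by simp
    qed
    ultimately show ?thesis by blast
  qed
  then show ?thesis using that outside[OF x] outside[OF y] by blast
qed

text \<open>Zorn's lemma gives a maximal family whose finite subfamilies have infinite intersection.
  If neither \<open>A\<close> nor \<open>- A\<close> belonged to it, the two finite subfamilies
  witnessing this would together have a finite intersection.\<close>

lemma free_ultrafilter_exists:
  obtains \<U> :: "nat set set"
  where "\<And>A. A \<in> \<U> \<or> - A \<in> \<U>" "\<And>A B. A \<in> \<U> \<Longrightarrow> B \<in> \<U> \<Longrightarrow> infinite (A \<inter> B)"
proof -
  define \<A> where "\<A> = {\<F> :: nat set set. \<forall>\<G>. finite \<G> \<longrightarrow> \<G> \<subseteq> \<F> \<longrightarrow> infinite (\<Inter>\<G>)}"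
  have "{} \<in> \<A>" unfolding \<A>_def by simp
  then have "\<A> \<noteq> {}" by blast
  moreover have "\<Union>\<C> \<in> \<A>" if chain: "\<C> \<noteq> {}" "subset.chain \<A> \<C>" for \<C>
    unfolding \<A>_def
  proof (intro CollectI allI impI)
    fix \<G> assume "finite \<G>" "\<G> \<subseteq> \<Union>\<C>"
    then obtain \<F> where "\<F> \<in> \<C>" "\<G> \<subseteq> \<F>"
      using finite_subset_Union_chain chain by metis
    moreover have "\<F> \<in> \<A>" using \<open>\<F> \<in> \<C>\<close> chain(2) unfolding subset.chain_def by blast
    ultimately show "infinite (\<Inter>\<G>)" using \<open>finite \<G>\<close> unfolding \<A>_def by blast
  qed
  ultimately obtain \<U> where \<U>: "\<U> \<in> \<A>" "\<And>\<F>. \<F> \<in> \<A> \<Longrightarrow> \<U> \<subseteq> \<F> \<Longrightarrow> \<F> = \<U>"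
    using subset_Zorn_nonempty[of \<A>] by blast
  have inter: "infinite (\<Inter>\<G>)" if "finite \<G>" "\<G> \<subseteq> \<U>" for \<G>
    using \<U>(1) that unfolding \<A>_def by blast
  have witness: "\<exists>\<G>. finite \<G> \<and> \<G> \<subseteq> \<U> \<and> finite (A \<inter> \<Inter>\<G>)" if A: "A \<notin> \<U>" for A
  proof -
    have "insert A \<U> \<notin> \<A>" using \<U>(2)[of "insert A \<U>"] A by blast
    then obtain \<G> where \<G>: "finite \<G>" "\<G> \<subseteq> insert A \<U>" "finite (\<Inter>\<G>)"
      unfolding \<A>_def by blast
    have "A \<inter> \<Inter>(\<G> - {A}) \<subseteq> \<Inter>\<G>" by blast
    then have "finite (A \<inter> \<Inter>(\<G> - {A}))" using \<G>(3) finite_subset by blast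
    then show ?thesis using \<G>(1,2) by (intro exI[of _ "\<G> - {A}"]) auto
  qed
  have "A \<in> \<U> \<or> - A \<in> \<U>" for A
  proof (rule ccontr)
    assume "\<not> (A \<in> \<U> \<or> - A \<in> \<U>)"
    then obtain \<G> \<H> where *: "finite \<G>" "\<G> \<subseteq> \<U>" "finite (A \<inter> \<Inter>\<G>)"
      "finite \<H>" "\<H> \<subseteq> \<U>" "finite (- A \<inter> \<Inter>\<H>)"
      using witness[of A] witness[of "- A"] by blast
    have "\<Inter>(\<G> \<union> \<H>) \<subseteq> (A \<inter> \<Inter>\<G>) \<union> (- A \<inter> \<Inter>\<H>)" by blast
    then have "finite (\<Inter>(\<G> \<union> \<H>))" using *(3,6) finite_subset by blast
    then show False using inter[of "\<G> \<union> \<H>"] *(1,2,4,5) by blast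
  qed
  moreover have "infinite (A \<inter> B)" if "A \<in> \<U>" "B \<in> \<U>" for A B
    using inter[of "{A, B}"] that by simp
  ultimately show ?thesis using that by blast
qed

lemma complete_open_not_meager:
  fixes U :: "'x::complete_space set"
  assumes "open U" "U \<noteq> {}"
  shows "\<not> meager U"
  using assms by (intro Baire_open_not_meager disjI1 completely_metrizable_space_euclidean)

text \<open>Otherwise balls with meager preimage in \<open>Q\<close> cover the complement of
  \<open>F\<close>. Countably many suffice by Lindelof, and \<open>F\<close> adds finitely many
  meager fibres, so \<open>Q\<close> would be meager. Excluding \<open>F\<close> allows distinct
  points to be chosen successively.\<close>

lemma support_point_exists:
  fixes \<sigma> :: "'x::topological_space \<Rightarrow> 'y::{metric_space, second_countable_topology}"
  assumes "\<not> meager Q" "\<And>y. meager (Q \<inter> \<sigma> -` {y})" "finite F"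
  obtains c where "c \<notin> F" "\<And>r. r > 0 \<Longrightarrow> \<not> meager (Q \<inter> \<sigma> -` ball c r)"
proof (rule ccontr)
  note witness = that
  assume "\<not> thesis"
  then have "\<exists>r>0. meager (Q \<inter> \<sigma> -` ball c r)" if "c \<notin> F" for c
    using witness[OF that] by blast
  then obtain r where r: "\<And>c. c \<notin> F \<Longrightarrow> r c > 0" "\<And>c. c \<notin> F \<Longrightarrow> meager (Q \<inter> \<sigma> -` ball c (r c))"
    by metis
  obtain \<F> where \<F>: "\<F> \<subseteq> (\<lambda>c. ball c (r c)) ` (- F)" "countable \<F>"
      "\<Union>\<F> = (\<Union>c\<in>- F. ball c (r c))"
    using Lindelof[of "(\<lambda>c. ball c (r c)) ` (- F)"] by blast
  have "meager (\<Union>V\<in>\<F>. Q \<inter> \<sigma> -` V)" using \<F>(1,2) r(2) by (intro meager_in_UN) auto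
  moreover have "meager (\<Union>y\<in>F. Q \<inter> \<sigma> -` {y})"
    using assms(2,3) by (intro meager_in_UN countable_finite)
  ultimately have "meager ((\<Union>V\<in>\<F>. Q \<inter> \<sigma> -` V) \<union> (\<Union>y\<in>F. Q \<inter> \<sigma> -` {y}))" by (rule meager_in_Un)
  moreover have "Q \<subseteq> (\<Union>V\<in>\<F>. Q \<inter> \<sigma> -` V) \<union> (\<Union>y\<in>F. Q \<inter> \<sigma> -` {y})"
  proof
    fix x assume "x \<in> Q"
    have "\<sigma> x \<in> F \<or> \<sigma> x \<in> \<Union>\<F>" unfolding \<F>(3) using r(1)[of "\<sigma> x"] by force
    then show "x \<in> (\<Union>V\<in>\<F>. Q \<inter> \<sigma> -` V) \<union> (\<Union>y\<in>F. Q \<inter> \<sigma> -` {y})" using \<open>x \<in> Q\<close> by blast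
  qed
  ultimately show False using assms(1) meager_in_subset by blast
qed

lemma distinct_support_points:
  fixes \<sigma> :: "'x::topological_space \<Rightarrow> 'y::{metric_space, second_countable_topology}"
    and Q :: "nat \<Rightarrow> 'x set"
  assumes "\<And>n. \<not> meager (Q n)" "\<And>n y. meager (Q n \<inter> \<sigma> -` {y})"
  obtains e where "inj e" "\<And>n r. r > 0 \<Longrightarrow> \<not> meager (Q n \<inter> \<sigma> -` ball (e n) r)"
proof -
  define supp where "supp n c \<longleftrightarrow> (\<forall>r>0. \<not> meager (Q n \<inter> \<sigma> -` ball c r))" for n c
  have ex: "\<exists>c. c \<notin> F \<and> supp n c" if "finite F" for F n
    using support_point_exists[OF assms that] unfolding supp_def by metis
  have "\<exists>f. \<forall>n. (finite (fst (f n)) \<and> snd (f n) \<notin> fst (f n) \<and> supp n (snd (f n))) \<and>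
      fst (f (Suc n)) = insert (snd (f n)) (fst (f n))"
  proof (rule dependent_nat_choice)
    obtain c where "supp 0 c" using ex[of "{}" 0] by blast
    then show "\<exists>x. finite (fst x) \<and> snd x \<notin> fst x \<and> supp 0 (snd x)" by (intro exI[of _ "({}, c)"]) simp
  next
    fix x :: "'y set \<times> 'y" and n
    assume "finite (fst x) \<and> snd x \<notin> fst x \<and> supp n (snd x)"
    then obtain c where "c \<notin> insert (snd x) (fst x)" "supp (Suc n) c"
      using ex[of "insert (snd x) (fst x)" "Suc n"] by auto
    then show "\<exists>y. (finite (fst y) \<and> snd y \<notin> fst y \<and> supp (Suc n) (snd y)) \<and>
        fst y = insert (snd x) (fst x)"
      using \<open>finite (fst x) \<and> snd x \<notin> fst x \<and> supp n (snd x)\<close>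
      by (intro exI[of _ "(insert (snd x) (fst x), c)"]) simp
  qed
  then obtain f where f: "\<And>n. snd (f n) \<notin> fst (f n)" "\<And>n. supp n (snd (f n))"
      "\<And>n. fst (f (Suc n)) = insert (snd (f n)) (fst (f n))"
    by blast
  have mem: "snd (f i) \<in> fst (f j)" if "i < j" for i j
    using that by (induction j) (auto simp: f(3) less_Suc_eq)
  have "inj (\<lambda>n. snd (f n))"
    by (rule linorder_injI) (metis mem f(1))
  then show ?thesis using that f(2) unfolding supp_def by blast
qed

text \<open>A nonmeager \<open>N\<close> carrying such a \<open>\<sigma>\<close> would yield sets \<open>B i\<close> which, inside every basic
  open set, can be simultaneously decided in either way for all \<open>i\<close> in an arbitrarily long interval.
  The preimage of a free ultrafilter under \<open>x \<mapsto> {i. \<sigma> x \<in> B i}\<close> then lacks the Baire property.\<close>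

lemma meager_fibres_imp_meager:
  fixes \<sigma> :: "'x::polish_space \<Rightarrow> 'y::{metric_space, second_countable_topology}"
  assumes BP: "\<And>T. \<sigma> -` T \<in> baire_property_sets euclidean"
    and N: "N \<in> baire_property_sets euclidean" and fibres: "\<And>y. meager (N \<inter> \<sigma> -` {y})"
  shows "meager N"
proof (rule ccontr)
  assume nm: "\<not> meager N"
  obtain \<B> :: "'x set set" where \<B>: "countable \<B>" "topological_basis \<B>"
    using ex_countable_basis by blast
  obtain U0 where U0: "U0 \<in> \<B>" "\<not> meager (N \<inter> U0)" "meager (U0 - N)"
    using baire_property_sets_comeager_in_open[OF N \<B>, of UNIV] nm by auto
  have open_\<B>: "open U" if "U \<in> \<B>" for U using \<B>(2) that by (rule topological_basis_open)
  define J where "J = {U \<in> \<B>. U \<noteq> {} \<and> U \<subseteq> U0}"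
  have "U0 \<noteq> {}" using U0(2) meager_in_empty by (metis Int_empty_right)
  then have "J \<noteq> {}" using U0(1) unfolding J_def by blast
  define U where "U = from_nat_into J"
  have UJ: "U k \<in> J" for k unfolding U_def using \<open>J \<noteq> {}\<close> by (rule from_nat_into)
  have Usurj: "\<exists>k. U k = V" if "V \<in> J" for V
    using from_nat_into_surj[of J V] that \<B>(1) unfolding U_def J_def by auto
  have NU: "\<not> meager (N \<inter> U k)" for k
  proof
    assume "meager (N \<inter> U k)"
    from meager_in_Un[OF this U0(3)] have "meager (U k)"
      by (rule meager_in_subset) (use UJ[of k] in \<open>auto simp: J_def\<close>)
    then show False using complete_open_not_meager[of "U k"] UJ[of k] open_\<B> unfolding J_def by blast
  qed
  \<comment> \<open>Each basic set \<open>U k\<close> receives two support points: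
    \<open>e (2 * k)\<close>, to lie in the sets \<open>B i\<close>, and
    \<open>e (2 * k + 1)\<close>, to lie outside.\<close>
  obtain e where e: "inj e"
    "\<And>n r. r > 0 \<Longrightarrow> \<not> meager (N \<inter> U (n div 2) \<inter> \<sigma> -` ball (e n) r)"
  proof (rule distinct_support_points[of "\<lambda>n. N \<inter> U (n div 2)" \<sigma>])
    show "meager (N \<inter> U (n div 2) \<inter> \<sigma> -` {y})" for n y
      using fibres[of y] by (rule meager_in_subset) auto
  qed (use NU in auto)
  \<comment> \<open>Half the least distance between the first \<open>2 * i + 2\<close> points serves
    as a radius, so balls around different ones are disjoint. The element \<open>1\<close> makes
    nonemptiness evident.\<close>
  define S where "S i = insert 1 ((\<lambda>(a, b). dist (e a) (e b)) ` {(a, b). a \<le> 2 * i + 1 \<and> b \<le> 2 * i + 1 \<and> a \<noteq> b})" for i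
  define r where "r i = Min (S i) / 2" for i
  have S_fin: "finite (S i)" for i
  proof -
    have "{(a, b). a \<le> 2 * i + 1 \<and> b \<le> 2 * i + 1 \<and> a \<noteq> b} \<subseteq> {..2 * i + 1} \<times> {..2 * i + 1}" by auto
    then show ?thesis unfolding S_def using finite_subset by fastforce
  qed
  have r_pos: "r i > 0" for i
  proof -
    have "s > 0" if "s \<in> S i" for s using that e(1) unfolding S_def by (auto dest: injD)
    then show ?thesis using S_fin[of i] unfolding r_def by (simp add: S_def)
  qed
  have r_mono: "r j \<le> r i" if "i \<le> j" for i j
  proof -
    have "S i \<subseteq> S j" unfolding S_def using that by (intro insert_mono image_mono) auto
    then have "Min (S j) \<le> Min (S i)" using S_fin[of j] by (intro Min_antimono) (auto simp: S_def)
    then show ?thesis unfolding r_def by simp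
  qed
  have r_dist: "2 * r i \<le> dist (e a) (e b)" if "a \<le> 2 * i + 1" "b \<le> 2 * i + 1" "a \<noteq> b" for i a b
  proof -
    have "dist (e a) (e b) \<in> S i" using that unfolding S_def by auto
    then show ?thesis using Min_le[OF S_fin[of i]] unfolding r_def by simp
  qed
  \<comment> \<open>For \<open>k \<le> i \<le> m\<close> the ball of radius \<open>r m\<close>
    around \<open>e (2 * k)\<close> lies in \<open>B i\<close>, and the one around
    \<open>e (2 * k + 1)\<close> misses it. Thus a nonmeager piece of \<open>U k\<close> decides all
    these \<open>B i\<close> at once.\<close>
  define B where "B i = (\<Union>k\<le>i. ball (e (2 * k)) (r i))" for i
  have inside: "ball (e (2 * k)) (r m) \<subseteq> B i" if "k \<le> i" "i \<le> m" for k i m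
    using that r_mono[of i m] unfolding B_def by (force simp: subset_iff)
  have outside: "ball (e (2 * k + 1)) (r m) \<subseteq> - B i" if "k \<le> i" "i \<le> m" for k i m
  proof -
    have "ball (e (2 * k + 1)) (r m) \<inter> ball (e (2 * j)) (r i) = {}" if "j \<le> i" for j
    proof (rule ccontr)
      assume "\<not> ?thesis"
      then obtain w where w: "dist (e (2 * k + 1)) w < r m" "dist (e (2 * j)) w < r i" by auto
      have "2 * k + 1 \<noteq> 2 * j" by presburger
      then have "2 * r i \<le> dist (e (2 * k + 1)) (e (2 * j))"
        using r_dist[of "2 * k + 1" i "2 * j"] \<open>k \<le> i\<close> \<open>j \<le> i\<close> by simp
      then show False
        using w r_mono[OF \<open>i \<le> m\<close>] dist_triangle2[of "e (2 * k + 1)" "e (2 * j)" w] by linarith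
    qed
    then show ?thesis unfolding B_def by blast
  qed
  \<comment> \<open>Applied below to the ultrafilter preimage with the sets \<open>- B i\<close> and
    \<open>p = 1\<close>, and to its complement with the sets \<open>B i\<close> and
    \<open>p = 0\<close>.\<close>
  have two_points: "\<exists>x y i0. x \<in> G \<and> y \<in> G \<and> (\<forall>i\<ge>i0. \<sigma> x \<in> A i \<or> \<sigma> y \<in> A i)"
    if G: "G \<in> baire_property_sets euclidean" "\<not> meager (G \<inter> U0)"
      and A: "\<And>k i m. k \<le> i \<Longrightarrow> i \<le> m \<Longrightarrow> ball (e (2 * k + p)) (r m) \<subseteq> A i" and "p < 2"
    for G A p
  proof -
    obtain W0 where W0: "W0 \<in> \<B>" "\<not> meager (G \<inter> U0 \<inter> W0)" "meager (W0 - G)"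
      using baire_property_sets_comeager_in_open[OF G(1) \<B> G(2)] by blast
    define W where "W = W0 \<inter> U0"
    have W: "open W" "W \<noteq> {}"
      using open_\<B>[OF W0(1)] open_\<B>[OF U0(1)] W0(2) meager_in_empty[of euclidean]
      unfolding W_def by (auto simp: Int_assoc Int_commute[of U0])
    have "\<exists>P. open P \<and> meager ((\<sigma> -` A i - P) \<union> (P - \<sigma> -` A i))" for i
      using baire_property_setsE[OF BP[of "A i"]] meager_in_Un by metis
    then obtain P where P: "\<And>i. open (P i)" "\<And>i. meager ((\<sigma> -` A i - P i) \<union> (P i - \<sigma> -` A i))"
      by metis
    define M where "M = (W0 - G) \<union> (\<Union>i. (\<sigma> -` A i - P i) \<union> (P i - \<sigma> -` A i))"
    have M: "meager M" unfolding M_def by (intro meager_in_Un W0(3) meager_in_UN_nat P(2))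
    obtain x y i0 where xy: "x \<in> W - M" "y \<in> W - M" "\<And>i. i \<ge> i0 \<Longrightarrow> x \<in> P i \<or> y \<in> P i"
    proof (rule fusion_two_points[OF P(1) W _ M])
      fix V assume V: "open V" "V \<noteq> {}" "V \<subseteq> W"
      then obtain v where "v \<in> V" by blast
      then obtain V' where "V' \<in> \<B>" "v \<in> V'" "V' \<subseteq> V"
        using topological_basisE[OF \<B>(2) V(1)] by metis
      then have "V' \<in> J" using V(3) unfolding J_def W_def by blast
      then obtain k where k: "U k = V'" using Usurj by blast
      \<comment> \<open>The position \<open>k\<close> of a basic subset of \<open>V\<close> in the
        enumeration is the starting index: an empty intersection would put the nonmeager piece at
        \<open>e (2 * k + p)\<close> into \<open>M\<close>.\<close>
      have "V \<inter> (\<Inter>i\<in>{k..<m}. P i) \<noteq> {}" for m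
      proof
        assume empty: "V \<inter> (\<Inter>i\<in>{k..<m}. P i) = {}"
        have "N \<inter> U k \<inter> \<sigma> -` ball (e (2 * k + p)) (r m) \<subseteq> M"
        proof
          fix x assume x: "x \<in> N \<inter> U k \<inter> \<sigma> -` ball (e (2 * k + p)) (r m)"
          then have "x \<in> V" using k \<open>V' \<subseteq> V\<close> by blast
          then have "x \<notin> (\<Inter>i\<in>{k..<m}. P i)" using empty by blast
          then obtain i where i: "k \<le> i" "i < m" "x \<notin> P i" by auto
          then have "\<sigma> x \<in> A i" using A[of k i m] x by auto
          then show "x \<in> M" using i(3) unfolding M_def by blast
        qed
        moreover have "(2 * k + p) div 2 = k" using \<open>p < 2\<close> by simp
        ultimately show False using e(2)[OF r_pos, of "2 * k + p" m] meager_in_subset[OF M] by simp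
      qed
      then show "\<exists>k. \<forall>m. V \<inter> (\<Inter>i\<in>{k..<m}. P i) \<noteq> {}" by blast
    qed blast
    then have "x \<in> G" "y \<in> G" unfolding M_def W_def by auto
    moreover have "\<sigma> x \<in> A i \<or> \<sigma> y \<in> A i" if "i \<ge> i0" for i
      using xy(1,2) xy(3)[OF that] unfolding M_def by blast
    ultimately show ?thesis by blast
  qed
  obtain \<U> :: "nat set set" where \<U>: "\<And>A. A \<in> \<U> \<or> - A \<in> \<U>"
      "\<And>A B. A \<in> \<U> \<Longrightarrow> B \<in> \<U> \<Longrightarrow> infinite (A \<inter> B)"
    using free_ultrafilter_exists by blast
  define I where "I x = {i. \<sigma> x \<in> B i}" for x
  define V where "V = {x. I x \<in> \<U>}"
  have "V = \<sigma> -` {t. {i. t \<in> B i} \<in> \<U>}" unfolding V_def I_def by auto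
  then have V: "V \<in> baire_property_sets euclidean" using BP by metis
  have "\<not> meager U0" using U0(2) meager_in_subset by blast
  then have "\<not> meager (V \<inter> U0) \<or> \<not> meager (- V \<inter> U0)"
    using meager_in_Un[of euclidean "V \<inter> U0" "- V \<inter> U0"] by (metis Int_Un_distrib2 Compl_partition Int_UNIV_left)
  then show False
  proof
    assume "\<not> meager (V \<inter> U0)"
    then obtain x y i0 where xy: "x \<in> V" "y \<in> V" "\<forall>i\<ge>i0. \<sigma> x \<in> - B i \<or> \<sigma> y \<in> - B i"
      using two_points[OF V, of 1 "\<lambda>i. - B i"] outside by auto
    then have "I x \<inter> I y \<subseteq> {..<i0}" unfolding I_def by (auto simp: not_le[symmetric])
    then show False using \<U>(2)[of "I x" "I y"] xy(1,2) finite_subset unfolding V_def by blast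
  next
    assume "\<not> meager (- V \<inter> U0)"
    then obtain x y i0 where xy: "x \<in> - V" "y \<in> - V" "\<forall>i\<ge>i0. \<sigma> x \<in> B i \<or> \<sigma> y \<in> B i"
      using two_points[OF baire_property_sets_compl[OF V], of 0 B] inside by auto
    then have "- I x \<inter> - I y \<subseteq> {..<i0}" unfolding I_def by (auto simp: not_le[symmetric])
    moreover have "- I x \<in> \<U>" "- I y \<in> \<U>" using xy(1,2) \<U>(1) unfolding V_def by auto
    ultimately show False using \<U>(2) finite_subset by blast
  qed
qed

text \<open>Nonmeager fibres are comeager in distinct basic open sets, so they are countably many.
  The remaining fibres are meager and all their unions have the Baire property, so their total union
  is meager.\<close>

lemma essentially_countable_range:
  fixes \<pi> :: "'x::polish_space \<Rightarrow> 't"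
  assumes BP: "\<And>T. \<pi> -` T \<in> baire_property_sets euclidean"
  obtains C where "countable C" "meager (\<pi> -` (- C))"
proof -
  obtain \<B> :: "'x set set" where \<B>: "countable \<B>" "topological_basis \<B>"
    using ex_countable_basis by blast
  define C where "C = {t. \<not> meager (\<pi> -` {t})}"
  have "\<exists>U\<in>\<B>. \<not> meager (\<pi> -` {t} \<inter> U) \<and> meager (U - \<pi> -` {t})" if "t \<in> C" for t
    using baire_property_sets_comeager_in_open[OF BP[of "{t}"] \<B>, of UNIV] that unfolding C_def by auto
  then obtain U where U: "\<And>t. t \<in> C \<Longrightarrow> U t \<in> \<B>" "\<And>t. t \<in> C \<Longrightarrow> \<not> meager (\<pi> -` {t} \<inter> U t)"
      "\<And>t. t \<in> C \<Longrightarrow> meager (U t - \<pi> -` {t})"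
    by metis
  have "inj_on U C"
  proof (rule inj_onI, rule ccontr)
    fix s t assume *: "s \<in> C" "t \<in> C" "U s = U t" "s \<noteq> t"
    then have "\<pi> -` {s} \<inter> U s \<subseteq> U t - \<pi> -` {t}" by auto
    then show False using U(2)[OF *(1)] U(3)[OF *(2)] meager_in_subset by blast
  qed
  then have "countable C"
    using U(1) \<B>(1) by (meson countable_image_inj_on countable_subset image_subsetI)
  \<comment> \<open>Replacing an attained value by a point of its fibre moves the values into the
    domain, a separable metric space.\<close>
  define rep where "rep t = (SOME x. \<pi> x = t)" for t
  define N where "N = \<pi> -` (- C)"
  have \<pi>_rep: "\<pi> (rep (\<pi> x)) = \<pi> x" for x unfolding rep_def by (rule someI) simp
  have "meager N"
  proof (rule meager_fibres_imp_meager[of "rep \<circ> \<pi>"])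
    show "(rep \<circ> \<pi>) -` T \<in> baire_property_sets euclidean" for T
      using BP[of "rep -` T"] by (simp add: vimage_comp)
    show "N \<in> baire_property_sets euclidean" unfolding N_def by (rule BP)
    fix y
    show "meager (N \<inter> (rep \<circ> \<pi>) -` {y})"
    proof (cases "\<pi> y \<in> C")
      case True
      then have "N \<inter> (rep \<circ> \<pi>) -` {y} = {}" unfolding N_def using \<pi>_rep by auto
      then show ?thesis by (simp add: meager_in_empty)
    next
      case False
      then have "meager (\<pi> -` {\<pi> y})" unfolding C_def by blast
      then show ?thesis by (rule meager_in_subset) (use \<pi>_rep in auto)
    qed
  qed
  then show ?thesis using that \<open>countable C\<close> unfolding N_def by blast
qed

section \<open>Maps with the Baire property\<close>

text \<open>Stone's trick: points that are at least \<open>1 / Suc n\<close> deep in the ball around the centre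
  chosen for them are \<open>1 / Suc n\<close>-separated when their centres differ.\<close>

lemma nearby_centre_borel:
  fixes \<epsilon> :: real
  assumes "\<epsilon> > 0"
  obtains \<tau> :: "'z::metric_space \<Rightarrow> 'z"
  where "\<And>y. dist y (\<tau> y) < \<epsilon>" "\<And>T. \<tau> -` T \<in> sets borel"
proof -
  obtain r :: "'z rel" where r: "well_order_on UNIV r" using well_order_on[of UNIV] by metis
  define R where "R = r - Id"
  have wf: "wf R" using r unfolding R_def well_order_on_def by (elim conjE)
  have "total r" using r unfolding well_order_on_def linear_order_on_def by (elim conjE)
  then have total: "(a, b) \<in> R \<or> (b, a) \<in> R" if "a \<noteq> b" for a b
    using that unfolding R_def by (simp add: total_on_def)
  define least_near where "least_near y z \<longleftrightarrow>
    dist y z < \<epsilon> \<and> (\<forall>z'. (z', z) \<in> R \<longrightarrow> \<not> dist y z' < \<epsilon>)" for y z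
  have "\<exists>z. least_near y z" for y
  proof -
    have "y \<in> {z. dist y z < \<epsilon>}" using assms by simp
    then have "\<exists>z\<in>{z. dist y z < \<epsilon>}. \<forall>z'. (z', z) \<in> R \<longrightarrow> z' \<notin> {z. dist y z < \<epsilon>}"
      using wf_eq_minimal[THEN iffD1, OF wf, rule_format, of y] by metis
    then obtain z where "dist y z < \<epsilon>" "\<forall>z'. (z', z) \<in> R \<longrightarrow> \<not> dist y z' < \<epsilon>"
      by blast
    then show ?thesis unfolding least_near_def by blast
  qed
  then obtain \<tau> where "\<And>y. least_near y (\<tau> y)" by metis
  then have \<tau>: "dist y (\<tau> y) < \<epsilon>" "(z', \<tau> y) \<in> R \<Longrightarrow> \<not> dist y z' < \<epsilon>" for y z'
    unfolding least_near_def by simp_all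
  have "\<tau> -` T \<in> sets borel" for T
  proof -
    define F where "F n = {y. \<tau> y \<in> T \<and> ball y (inverse (Suc n)) \<subseteq> ball (\<tau> y) \<epsilon>}" for n
    have "closed (F n)" for n
    proof -
      define \<delta> where "\<delta> = inverse (real (Suc n))"
      have "\<delta> > 0" unfolding \<delta>_def by simp
      have F: "w \<in> ball (\<tau> y) \<epsilon>" if "y \<in> F n" "dist y w < \<delta>" for y w
      proof -
        have "ball y \<delta> \<subseteq> ball (\<tau> y) \<epsilon>" using that(1) unfolding F_def \<delta>_def by simp
        then show ?thesis using that(2) by (simp add: subset_iff)
      qed
      have FT: "\<tau> y \<in> T" if "y \<in> F n" for y using that unfolding F_def by simp
      have same: "\<tau> a = \<tau> b" if ab: "a \<in> F n" "b \<in> F n" "dist a b < \<delta>" for a b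
      proof (rule ccontr)
        assume "\<tau> a \<noteq> \<tau> b"
        then consider "(\<tau> a, \<tau> b) \<in> R" | "(\<tau> b, \<tau> a) \<in> R" using total by blast
        then show False
        proof cases
          case 1
          have "dist b (\<tau> a) < \<epsilon>" using F[OF ab(1,3)] by (simp add: dist_commute)
          then show ?thesis using \<tau>(2)[OF 1] by contradiction
        next
          case 2
          have "dist a (\<tau> b) < \<epsilon>" using F[OF ab(2), of a] ab(3) by (simp add: dist_commute)
          then show ?thesis using \<tau>(2)[OF 2] by contradiction
        qed
      qed
      have "y \<in> F n" if y: "y \<in> closure (F n)" for y
      proof -
        have approx: "\<exists>a\<in>F n. dist a y < s" if "s > 0" for s
          using y that unfolding closure_approachable by blast
        obtain a where a: "a \<in> F n" "dist a y < \<delta> / 2" using approx[of "\<delta> / 2"] \<open>\<delta> > 0\<close> by auto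
        \<comment> \<open>Points of \<open>F n\<close> close to \<open>y\<close> share one centre by
          separation; the limit \<open>y\<close> inherits this centre and its depth from
          them.\<close>
        have near: "\<exists>b\<in>F n. dist b y < s \<and> \<tau> b = \<tau> a" if s: "s > 0" for s
        proof -
          obtain b where b: "b \<in> F n" "dist b y < min s (\<delta> / 2)"
            using approx[of "min s (\<delta> / 2)"] s \<open>\<delta> > 0\<close> by auto
          have "dist b a < \<delta>" using dist_triangle_half_l[of b y \<delta> a] a(2) b(2) by simp
          then show ?thesis using same[OF b(1) a(1)] b by auto
        qed
        have \<tau>_eq: "\<tau> y = \<tau> a"
        proof (rule ccontr)
          assume "\<tau> y \<noteq> \<tau> a"
          then consider "(\<tau> a, \<tau> y) \<in> R" | "(\<tau> y, \<tau> a) \<in> R" using total by blast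
          then show False
          proof cases
            case 1
            have "dist a y < \<delta>" using a(2) \<open>\<delta> > 0\<close> by simp
            then show ?thesis using \<tau>(2)[OF 1] F[OF a(1)] by (simp add: dist_commute)
          next
            case 2
            obtain b where b: "b \<in> F n" "dist b y < \<epsilon> - dist y (\<tau> y)" "\<tau> b = \<tau> a"
              using near[of "\<epsilon> - dist y (\<tau> y)"] \<tau>(1)[of y] by auto
            then have "dist b (\<tau> y) < \<epsilon>" using dist_triangle[of b "\<tau> y" y] by linarith
            then show ?thesis using \<tau>(2)[of "\<tau> y" b] 2 b(3) by simp
          qed
        qed
        have "w \<in> ball (\<tau> y) \<epsilon>" if w: "dist y w < \<delta>" for w
        proof -
          obtain b where b: "b \<in> F n" "dist b y < \<delta> - dist y w" "\<tau> b = \<tau> a"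
            using near[of "\<delta> - dist y w"] w by auto
          then have "dist b w < \<delta>" using dist_triangle[of b w y] by linarith
          then show ?thesis using F[OF b(1)] b(3) \<tau>_eq by simp
        qed
        then show ?thesis using \<tau>_eq FT[OF a(1)] unfolding F_def \<delta>_def by auto
      qed
      then show ?thesis using closure_subset_eq by blast
    qed
    then have "(\<Union>n. F n) \<in> sets borel" by (intro sets.countable_UN) auto
    moreover have "\<tau> -` T \<subseteq> (\<Union>n. F n)"
    proof
      fix y assume y: "y \<in> \<tau> -` T"
      obtain n where n: "inverse (real (Suc n)) < \<epsilon> - dist y (\<tau> y)"
        using reals_Archimedean[of "\<epsilon> - dist y (\<tau> y)"] \<tau>(1)[of y] by auto
      have "dist (\<tau> y) w < \<epsilon>" if "dist y w < inverse (real (Suc n))" for w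
        using dist_triangle[of "\<tau> y" w y] n that by (simp add: dist_commute)
      then have "y \<in> F n" using y unfolding F_def by (auto simp: subset_iff)
      then show "y \<in> (\<Union>n. F n)" by blast
    qed
    moreover have "(\<Union>n. F n) \<subseteq> \<tau> -` T" unfolding F_def by blast
    ultimately show ?thesis by (metis subset_antisym)
  qed
  then show ?thesis using \<tau>(1) that[of \<tau>] by metis
qed

lemma baire_property_map_vimage_borel:
  assumes "baire_property_map f" "A \<in> sets borel"
  shows "f -` A \<in> baire_property_sets euclidean"
proof -
  have "A \<in> sigma_sets UNIV {S. open S}" using assms(2) by (simp add: sets_borel)
  then show ?thesis
  proof (induction rule: sigma_sets.induct)
    case (Basic a)
    then show ?case using assms(1) unfolding baire_property_map_def by simp
  next
    case Empty
    show ?case by (simp add: meager_baire_property_sets meager_in_empty)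
  next
    case (Compl a)
    then show ?case
      using baire_property_sets_compl[of "f -` a"] by (simp add: vimage_Diff Compl_eq_Diff_UNIV)
  next
    case (Union a)
    then show ?case unfolding vimage_UN by (intro baire_property_sets_UN) auto
  qed
qed

text \<open>Rounding to centres at scale \<open>1 / Suc n\<close> gives a map under which every set
  has a preimage with the Baire property, so countably many centres suffice off a meager set.
  Collecting them over all scales gives \<open>C\<close>.\<close>

lemma baire_property_map_essentially_separable:
  fixes f :: "'x::polish_space \<Rightarrow> 'z::metric_space"
  assumes f: "baire_property_map f"
  obtains C where "countable C" "meager {x. f x \<notin> closure C}"
proof -
  have "\<exists>C. countable C \<and> meager {x. \<forall>c\<in>C. dist (f x) c \<ge> inverse (Suc n)}" for n
  proof -
    have pos: "inverse (real (Suc n)) > 0" by simp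
    obtain \<tau> :: "'z \<Rightarrow> 'z" where \<tau>: "\<And>y. dist y (\<tau> y) < inverse (real (Suc n))"
        "\<And>T. \<tau> -` T \<in> sets borel"
      using nearby_centre_borel[OF pos] by metis
    have "(\<tau> \<circ> f) -` T \<in> baire_property_sets euclidean" for T
      using baire_property_map_vimage_borel[OF f \<tau>(2)] by (simp add: vimage_comp)
    then obtain C where C: "countable C" "meager ((\<tau> \<circ> f) -` (- C))"
      using essentially_countable_range by blast
    have "{x. \<forall>c\<in>C. dist (f x) c \<ge> inverse (Suc n)} \<subseteq> (\<tau> \<circ> f) -` (- C)"
    proof
      fix x assume x: "x \<in> {x. \<forall>c\<in>C. dist (f x) c \<ge> inverse (Suc n)}"
      then have "\<tau> (f x) \<notin> C" using \<tau>(1)[of "f x"] by force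
      then show "x \<in> (\<tau> \<circ> f) -` (- C)" by simp
    qed
    then show ?thesis using C meager_in_subset by blast
  qed
  then obtain C where C: "\<And>n. countable (C n)" "\<And>n. meager {x. \<forall>c\<in>C n. dist (f x) c \<ge> inverse (Suc n)}"
    by metis
  have "meager (\<Union>n. {x. \<forall>c\<in>C n. dist (f x) c \<ge> inverse (Suc n)})" by (intro meager_in_UN_nat C(2))
  then have "meager {x. f x \<notin> closure (\<Union>n. C n)}"
  proof (rule meager_in_subset, intro subsetI)
    fix x assume "x \<in> {x. f x \<notin> closure (\<Union>n. C n)}"
    then obtain s where s: "s > 0" "\<forall>c\<in>(\<Union>n. C n). \<not> dist c (f x) < s"
      unfolding closure_approachable by blast
    obtain n where n: "inverse (real (Suc n)) < s" using reals_Archimedean s(1) by blast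
    have "dist (f x) c \<ge> inverse (Suc n)" if "c \<in> C n" for c
    proof -
      have "\<not> dist c (f x) < s" using s(2) that by blast
      then show ?thesis using n by (simp add: dist_commute)
    qed
    then show "x \<in> (\<Union>n. {x. \<forall>c\<in>C n. dist (f x) c \<ge> inverse (Suc n)})" by blast
  qed
  moreover have "countable (\<Union>n. C n)" using C(1) by simp
  ultimately show ?thesis using that by blast
qed

text \<open>Points of a countable \<open>C\<close> serve as intermediate points for the triangle
  inequality wherever \<open>g x\<close> lies in \<open>closure C\<close>; the exceptional points
  are put back as the meager set \<open>S\<close>.\<close>

lemma baire_property_sets_dist_less:
  fixes f g :: "'x::polish_space \<Rightarrow> 'z::metric_space"
  assumes f: "baire_property_map f" and g: "baire_property_map g"
  shows "{x. dist (f x) (g x) < e} \<in> baire_property_sets euclidean"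
proof -
  obtain C where C: "countable C" "meager {x. g x \<notin> closure C}"
    using baire_property_map_essentially_separable[OF g] by blast
  define R where "R = (\<Union>c\<in>C. \<Union>q\<in>\<rat>. f -` ball c (e - q) \<inter> g -` ball c q)"
  define S where "S = {x. dist (f x) (g x) < e} \<inter> {x. g x \<notin> closure C}"
  have "R \<in> baire_property_sets euclidean"
    using f g unfolding R_def baire_property_map_def
    by (intro baire_property_sets_UN baire_property_sets_Int C(1) countable_rat) auto
  moreover have "meager S" unfolding S_def using C(2) by (rule meager_in_subset) auto
  then have "S \<in> baire_property_sets euclidean" by (rule meager_baire_property_sets)
  ultimately have "R \<union> S \<in> baire_property_sets euclidean" by (rule baire_property_sets_Un)
  moreover have "R \<union> S = {x. dist (f x) (g x) < e}"
  proof (intro equalityI subsetI)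
    fix x assume x: "x \<in> R \<union> S"
    show "x \<in> {x. dist (f x) (g x) < e}"
    proof (cases "x \<in> S")
      case False
      then obtain c q where "dist c (f x) < e - q" "dist c (g x) < q" using x unfolding R_def by auto
      then have "dist (f x) (g x) < e" using dist_triangle3[of "f x" "g x" c] by linarith
      then show ?thesis by simp
    qed (simp add: S_def)
  next
    fix x assume x: "x \<in> {x. dist (f x) (g x) < e}"
    show "x \<in> R \<union> S"
    proof (cases "g x \<in> closure C")
      case True
      \<comment> \<open>Half the slack: one half pays for approximating \<open>g x\<close> by
        \<open>c\<close>, the other leaves room for the radius \<open>q\<close>.\<close>
      define s where "s = (e - dist (f x) (g x)) / 2"
      have "s > 0" using x unfolding s_def by simp
      then obtain c where c: "c \<in> C" "dist c (g x) < s" using True unfolding closure_approachable by blast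
      obtain q where q: "q \<in> \<rat>" "dist c (g x) < q" "q < s" using Rats_dense_in_real[OF c(2)] by blast
      have "dist c (f x) < e - q"
        using dist_triangle[of c "f x" "g x"] c(2) q(3) unfolding s_def by (simp add: dist_commute field_simps)
      then have "x \<in> R" using c(1) q unfolding R_def by auto
      then show ?thesis by blast
    qed (use x in \<open>simp add: S_def\<close>)
  qed
  ultimately show ?thesis by simp
qed

section \<open>Ideal convergence along generic sequences\<close>

text \<open>If at every scale some term had almost all terms close to it, the sequence would be
  Cauchy. Taking terms as reference points leaves countably many conditions.\<close>

lemma not_convergent_imp_separated:
  fixes z :: "nat \<Rightarrow> 'z::complete_space"
  assumes "\<not> convergent z"
  obtains i where "\<And>j. infinite {m. dist (z m) (z j) \<ge> inverse (real (Suc i))}"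
proof (rule ccontr)
  note witness = that
  assume "\<not> thesis"
  then have fin: "\<exists>j. finite {m. dist (z m) (z j) \<ge> inverse (real (Suc i))}" for i
    using witness by blast
  have "Cauchy z"
  proof (rule metric_CauchyI)
    fix \<epsilon> :: real assume "\<epsilon> > 0"
    then obtain i where i: "inverse (real (Suc i)) < \<epsilon> / 2" using reals_Archimedean[of "\<epsilon> / 2"] by auto
    obtain j where "finite {m. dist (z m) (z j) \<ge> inverse (real (Suc i))}" using fin by blast
    then obtain M where M: "\<And>m. dist (z m) (z j) \<ge> inverse (real (Suc i)) \<Longrightarrow> m < M"
      unfolding finite_nat_set_iff_bounded by blast
    have near: "dist (z m) (z j) < \<epsilon> / 2" if "m \<ge> M" for m
      using M[of m] that i by linarith
    have "dist (z m) (z n) < \<epsilon>" if "m \<ge> M" "n \<ge> M" for m n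
      using near[OF that(1)] near[OF that(2)] by (rule dist_triangle_half_l)
    then show "\<exists>M. \<forall>m\<ge>M. \<forall>n\<ge>M. dist (z m) (z n) < \<epsilon>" by blast
  qed
  then show False using assms by (simp add: Cauchy_convergent_iff)
qed

text \<open>As \<open>UNIV\<close> is not in the ideal, some term lies within
  \<open>\<delta> / 2\<close> of the ideal limit and can replace it.\<close>

lemma ideal_convergent_near_term:
  assumes I: "admissible_ideal I" and conv: "ideal_convergent I (\<lambda>n. z (s n))" and "\<delta> > 0"
  obtains j where "{n. dist (z (s n)) (z j) \<ge> \<delta>} \<in> I"
proof -
  obtain l where "ideal_converges_to I (\<lambda>n. z (s n)) l" using conv unfolding ideal_convergent_def by blast
  then have mem: "{n. dist (z (s n)) l \<ge> \<delta> / 2} \<in> I"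
    using half_gt_zero[OF \<open>\<delta> > 0\<close>] unfolding ideal_converges_to_def by blast
  have "UNIV \<notin> I" using I unfolding admissible_ideal_def by blast
  then have "{n. dist (z (s n)) l \<ge> \<delta> / 2} \<noteq> UNIV" using mem by metis
  then obtain n0 where n0: "dist (z (s n0)) l < \<delta> / 2"
    using linorder_not_le by blast
  have "{n. dist (z (s n)) (z (s n0)) \<ge> \<delta>} \<subseteq> {n. dist (z (s n)) l \<ge> \<delta> / 2}"
  proof
    fix n assume "n \<in> {n. dist (z (s n)) (z (s n0)) \<ge> \<delta>}"
    then show "n \<in> {n. dist (z (s n)) l \<ge> \<delta> / 2}"
      using dist_triangle2[of "z (s n)" "z (s n0)" l] n0 by simp
  qed
  then show ?thesis using admissible_ideal_subset[OF I mem] that by blast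
qed

lemma comeager_ideal_divergence:
  fixes f :: "nat \<Rightarrow> 'x::polish_space \<Rightarrow> 'z::complete_space" and Y :: "(nat \<Rightarrow> nat) set"
  assumes ext: "\<And>s N M A. s \<in> Y \<Longrightarrow> infinite A \<Longrightarrow>
      \<exists>s'\<in>Y. (\<forall>i<N. s' i = s i) \<and> (\<forall>i. N \<le> i \<and> i < M \<longrightarrow> s' i \<in> A)"
    and f: "\<And>n. baire_property_map (f n)"
    and I: "admissible_ideal I" "char_functions I \<in> baire_property_sets euclidean"
    and conv: "meager {x. convergent (\<lambda>n. f n x)}"
  shows "comeager_in (top_of_set Y) {s \<in> Y. meager {x. ideal_convergent I (\<lambda>n. f (s n) x)}}"
proof -
  obtain b :: "nat \<Rightarrow> nat" where b: "strict_mono b" "\<And>A. A \<in> I \<Longrightarrow> finite {k. {b k..<b (Suc k)} \<subseteq> A}"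
    using ideal_baire_property_blocks[OF I] by blast
  define D where "D i j m = {x. dist (f m x) (f j x) \<ge> inverse (real (Suc i))}" for i j m
  define E where "E i = {x. \<forall>j. infinite {m. x \<in> D i j m}}" for i
  define bad where "bad s = (\<lambda>(i, j, K). {x \<in> E i. \<not> (\<exists>k\<ge>K. \<forall>n\<in>{b k..<b (Suc k)}. x \<in> D i j (s n))})" for s :: "nat \<Rightarrow> nat"
  have D: "D i j m \<in> baire_property_sets euclidean" for i j m
  proof -
    have "D i j m = - {x. dist (f m x) (f j x) < inverse (real (Suc i))}" unfolding D_def by auto
    then show ?thesis by (metis baire_property_sets_compl baire_property_sets_dist_less f)
  qed
  have "comeager_in (top_of_set Y) {s \<in> Y. meager (bad s t)}" for t
  proof -
    obtain i j K where t: "t = (i, j, K)" by (cases t) auto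
    have "infinite {m. x \<in> D i j m}" if "x \<in> E i" for x using that unfolding E_def by blast
    from comeager_block_capture[OF ext D this b(1)] show ?thesis unfolding t bad_def by simp
  qed
  then have "comeager_in (top_of_set Y) (\<Inter>t\<in>UNIV. {s \<in> Y. meager (bad s t)})"
    by (intro comeager_in_INT) auto
  then show ?thesis
  proof (rule comeager_in_superset)
    show "(\<Inter>t\<in>UNIV. {s \<in> Y. meager (bad s t)}) \<subseteq> {s \<in> Y. meager {x. ideal_convergent I (\<lambda>n. f (s n) x)}}"
    proof
      fix s assume "s \<in> (\<Inter>t\<in>UNIV. {s \<in> Y. meager (bad s t)})"
      then have s: "s \<in> Y" "\<And>t. meager (bad s t)" by auto
      have "meager (\<Union>t. bad s t)" by (rule meager_in_UN) (auto simp: s(2))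
      from meager_in_Un[OF conv this]
      have "meager {x. ideal_convergent I (\<lambda>n. f (s n) x)}"
      proof (rule meager_in_subset, intro subsetI)
        fix x assume "x \<in> {x. ideal_convergent I (\<lambda>n. f (s n) x)}"
        then have x: "ideal_convergent I (\<lambda>n. f (s n) x)" by simp
        show "x \<in> {x. convergent (\<lambda>n. f n x)} \<union> (\<Union>t. bad s t)"
        proof (cases "convergent (\<lambda>n. f n x)")
          case False
          then obtain i where i: "\<And>j. infinite {m. dist (f m x) (f j x) \<ge> inverse (real (Suc i))}"
            using not_convergent_imp_separated[of "\<lambda>n. f n x"] by metis
          obtain j where j: "{n. dist (f (s n) x) (f j x) \<ge> inverse (real (Suc i))} \<in> I"
            using ideal_convergent_near_term[OF I(1), of "\<lambda>n. f n x" s "inverse (real (Suc i))"] x by auto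
          \<comment> \<open>Only finitely many blocks lie inside this member of the ideal; beyond
            them no block captures \<open>x\<close>, which puts \<open>x\<close> into
            \<open>bad s (i, j, K)\<close>.\<close>
          obtain K where "{k. {b k..<b (Suc k)} \<subseteq> {n. x \<in> D i j (s n)}} \<subseteq> {..<K}"
            using b(2)[OF j] finite_nat_iff_bounded unfolding D_def by auto
          then have "\<not> {b k..<b (Suc k)} \<subseteq> {n. x \<in> D i j (s n)}" if "k \<ge> K" for k
            using that by (auto simp: not_less[symmetric])
          then have "\<not> (\<exists>k\<ge>K. \<forall>n\<in>{b k..<b (Suc k)}. x \<in> D i j (s n))" by blast
          moreover have "x \<in> E i" using i unfolding E_def D_def by simp
          ultimately have "x \<in> bad s (i, j, K)" unfolding bad_def by simp
          then show ?thesis by blast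
        qed simp
      qed
      then show "s \<in> {s \<in> Y. meager {x. ideal_convergent I (\<lambda>n. f (s n) x)}}" using s(1) by simp
    qed
  qed auto
qed

theorem corollary2p4:
  fixes f :: "nat \<Rightarrow> 'x::polish_space \<Rightarrow> 'z::complete_space"
    and I :: "nat set set"
  assumes "\<And>n. baire_property_map (f n)"
    and "admissible_ideal I"
    and "analytic_set (char_functions I) \<or> coanalytic_set (char_functions I)"
    and "comeager_in euclidean {x. \<not> convergent (\<lambda>n. f n x)}"
  shows "comeager_in (top_of_set S_space)
           {s \<in> S_space. meager_in euclidean {x. ideal_convergent I (\<lambda>n. f (s n) x)}}
       \<and> comeager_in (top_of_set P_space)
           {p \<in> P_space. meager_in euclidean {x. ideal_convergent I (\<lambda>n. f (p n) x)}}"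
proof -
  have BP: "char_functions I \<in> baire_property_sets euclidean"
    using assms(3) by (rule char_functions_baire_property)
  have "topspace euclidean - {x. \<not> convergent (\<lambda>n. f n x)} = {x. convergent (\<lambda>n. f n x)}" by auto
  then have conv: "meager {x. convergent (\<lambda>n. f n x)}"
    using assms(4) unfolding comeager_in_def by metis
  show ?thesis
    using comeager_ideal_divergence[OF S_space_extension assms(1,2) BP conv]
      comeager_ideal_divergence[OF P_space_extension assms(1,2) BP conv] by blast
qed

end
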